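(* Let $\pi_1:V_1\to X_1$ and $\pi_2:V_2\to X_2$ be finite-dimensional locally trivial diffeological vector pseudo-bundles, let $(\tilde f,f)$ be a gluing of the former to the latter such that $f$ and $\tilde f^*$ are diffeomorphisms (of their domains with their images), and let $g_1,g_2$ be pseudo-metrics on $V_1,V_2$ compatible with this gluing. Let $v\in C\ell(V_1\cup_{\tilde f}V_2,\tilde g)$ and $e\in\bigwedge_*(V_1\cup_{\tilde f}V_2)$ be such that $\pi^{C\ell}(v)=\pi^{\bigwedge_*}(e)$ (they lie over the same point of $X_1\cup_fX_2$). Then $$\Phi^{\bigwedge_*}(c_*(v)(e))=\tilde c_*\left((\Phi^{C\ell})^{-1}(v)\right)\left(\Phi^{\bigwedge_*}(e)\right).$$
   Context: Diffeological spaces, plots, smooth maps, and the subset, quotient, product, disjoint union and functional diffeologies are in the usual sense of Souriau. $E^*$ denotes the space of smooth linear maps $E\to\mathbb R$ on a diffeological vector space $E$, with the functional diffeology. Pseudo-bundles. A diffeological vector pseudo-bundle is a smooth surjective map $\pi:V\to X$ of diffeological spaces with a vector space structure on each fibre such that fibrewise addition $V\times_XV\to V$, scalar multiplication $\mathbb R\times V\to V$ and the zero section are smooth. The dual pseudo-bundle is $V^*=\bigcup_{x}(\pi^{-1}(x))^*$; $q:U'\to V^*$ is a plot iff for every plot $p:U\to V$ the map $(u',u)\mapsto q(u')(p(u))$ is smooth on the set where $q(u')$ and $p(u)$ lie over the same point. $V\oplus V'$ is $V\times_XV'$ with the subset diffeology; $V\otimes V'$ is the fibrewise tensor product, with the finest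 pseudo-bundle diffeology making $V\times_XV'\to V\otimes V'$ smooth. A pseudo-metric on $V$ (finite-dimensional fibres) is a smooth section $g$ of $V^*\otimes V^*$ such that each $g(x)$ is a symmetric positive semi-definite form of rank $\dim((\pi^{-1}(x))^* )$. Gluing. For $h:Z_1\supseteq Y'\to Z_2$ smooth, $Z_1\cup_hZ_2=(Z_1\sqcup Z_2)/(z\sim h(z))$ with the quotient of the disjoint union diffeology. The natural inclusions of $Z_1\setminus Y'$ and of $Z_2$ have disjoint images covering it; they are denoted $i_1^{Z_1},i_2^{Z_2}$ for base spaces and $j_1^{Z_1},j_2^{Z_2}$ for total spaces. A gluing $(\tilde f,f)$ consists of a smooth $f:X_1\supseteq Y\to X_2$ and a smooth fibrewise linear lift $\tilde f:\pi_1^{-1}(Y)\to V_2$; it yields the pseudo-bundle $V_1\cup_{\tilde f}V_2\to X_1\cup_fX_2$. The map $\tilde f^*:(\pi_2^* )^{-1}(f(Y))\to V_1^*$ is $\xi\mapsto\xi\circ\tilde f|_{\pi_1^{-1}(y)}$ for $\xi\in(\pi_2^{-1}(f(y)))^*$. Pseudo-metrics $g_1,g_2$ are compatible with $(\tilde f,f)$ if $g_1(y)(v,w)=g_2(f(y))(\tilde f(v),\tilde f(w))$ for all $y\in Y$, $v,w\in\pi_1^{-1}(y)$. Then $\tilde g$ is the pseudo-metric on $V_1\cup_{\tilde f}V_2$ equal to $g_1$ (via $j_1^{V_1}$) on fibres over $i_1^{X_1}(X_1\setminus Y)$ and to $g_2$ (via $j_2^{V_2}$) on fibres over $i_2^{X_2}(X_2)$.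 Clifford algebras. The dimensions of all fibres are assumed bounded; $\dim_V$ is the supremum of the dimensions of fibres of $V_1$ and $V_2$. $C\ell(V,g)=\bigcup_xC\ell(\pi^{-1}(x),g(x))$, where the Clifford algebra is the quotient of the tensor algebra by the relations $v\otimes w+w\otimes v+2g(x)(v,w)=0$, with projection $\pi^{C\ell}$ and the quotient diffeology from the pseudo-bundle $T(V)$ of tensor algebras (finite direct sums of tensor powers, up to the maximal fibre dimension, suffice). $\tilde F^{C\ell}$ is the fibrewise algebra homomorphism, from the part of $C\ell(V_1,g_1)$ over $Y$ to $C\ell(V_2,g_2)$, induced by $\tilde f$. $\Phi^{C\ell}:C\ell(V_1,g_1)\cup_{\tilde F^{C\ell}}C\ell(V_2,g_2)\to C\ell(V_1\cup_{\tilde f}V_2,\tilde g)$ is the natural fibrewise identification: on the image of $j_i^{C\ell(V_i,g_i)}$ it is the inverse of $j_i^{C\ell(V_i,g_i)}$ followed by the fibrewise algebra extension of $j_i^{V_i}$, $i=1,2$. Exterior algebras. $\mathrm{Alt}(v_1\otimes\cdots\otimes v_n)=\frac1{n!}\sum_\sigma\mathrm{sgn}(\sigma)v_{\sigma(1)}\otimes\cdots\otimes v_{\sigma(n)}$ (fibrewise), $\bigwedge_n(V)=\mathrm{Alt}(V^{\otimes n})$, $\bigwedge_*(V)=\bigoplus_n\bigwedge_n(V)$, with projection $\pi^{\bigwedge_*}$ and $v_1\wedge\cdots\wedge v_n=\mathrm{Alt}(v_1\otimes\cdots\otimes v_n)$. $\tilde f^{\bigwedge_*}$ is the restriction of $\bigoplus_n\tilde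 f^{\otimes n}$ to the part of $\bigwedge_*(V_1)$ over $Y$, with values in $\bigwedge_*(V_2)$. $\Phi_{\cup,\otimes}^{(\otimes n)}:(V_1\cup_{\tilde f}V_2)^{\otimes n}\to V_1^{\otimes n}\cup_{\tilde f^{\otimes n}}V_2^{\otimes n}$ is determined by $\Phi_{\cup,\otimes}^{(\otimes n)}\circ(j_i^{V_i})^{\otimes n}=j_i^{V_i^{\otimes n}}$, and $\Phi_{\cup,\oplus}^{(k)}:\bigoplus_{n=0}^k(V_1^{\otimes n}\cup_{\tilde f^{\otimes n}}V_2^{\otimes n})\to(\bigoplus_nV_1^{\otimes n})\cup_{\oplus_n\tilde f^{\otimes n}}(\bigoplus_nV_2^{\otimes n})$ by the analogous identities for direct sums. Finally $\Phi^{\bigwedge_*}=\Phi_{\cup,\oplus}^{(\dim_V)}\circ\bigoplus_n\Phi_{\cup,\otimes}^{(\otimes n)}$ restricted to $\bigwedge_*(V_1\cup_{\tilde f}V_2)$, with values in $\bigwedge_*(V_1)\cup_{\tilde f^{\bigwedge_*}}\bigwedge_*(V_2)$. Actions. The standard Clifford action of $C\ell(V,g)$ on $\bigwedge_*(V)$ is the fibrewise algebra homomorphism into endomorphisms determined on $v\in V$ by $c(v)(v_1\wedge\cdots\wedge v_k)=v\wedge v_1\wedge\cdots\wedge v_k-\sum_{j=1}^k(-1)^{j+1}g(\pi(v))(v,v_j)\,v_1\wedge\cdots\wedge v_{j-1}\wedge v_{j+1}\wedge\cdots\wedge v_k$. $c_*$ is the standard action of $C\ell(V_1\cup_{\tilde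 f}V_2,\tilde g)$ on $\bigwedge_*(V_1\cup_{\tilde f}V_2)$; $c_i$ is the standard action of $C\ell(V_i,g_i)$ on $\bigwedge_*(V_i)$. $\tilde c_*$ is the action of $C\ell(V_1,g_1)\cup_{\tilde F^{C\ell}}C\ell(V_2,g_2)$ on $\bigwedge_*(V_1)\cup_{\tilde f^{\bigwedge_*}}\bigwedge_*(V_2)$ given by $\tilde c_*(v)(e)=j_i^{\bigwedge_*(V_i)}\bigl(c_i((j_i^{C\ell(V_i,g_i)})^{-1}(v))((j_i^{\bigwedge_*(V_i)})^{-1}(e))\bigr)$, with $i=1$ over $i_1^{X_1}(X_1\setminus Y)$ and $i=2$ over $i_2^{X_2}(X_2)$. *)

theory Defs
  imports "HOL-Analysis.Analysis" "HOL-Analysis.Abstract_Euclidean_Space" "HOL-Library.Poly_Mapping"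
begin

section \<open>Diffeological spaces\<close>

text \<open>Domains of plots are open subsets of \<open>\<real>\<^sup>n\<close>, realised by the library space
  \<^const>\<open>Euclidean_space\<close> (sequences of reals vanishing from index \<open>n\<close> on), since \<open>n\<close> varies.\<close>

fun C_k :: "nat \<Rightarrow> nat \<Rightarrow> (nat \<Rightarrow> real) set \<Rightarrow> ((nat \<Rightarrow> real) \<Rightarrow> real) \<Rightarrow> bool" where
  "C_k 0 n U f \<longleftrightarrow> continuous_map (subtopology (Euclidean_space n) U) euclideanreal f"
| "C_k (Suc k) n U f \<longleftrightarrow>
     continuous_map (subtopology (Euclidean_space n) U) euclideanreal f \<and>
     (\<forall>i<n. \<exists>f'. (\<forall>u\<in>U. ((\<lambda>t. f (u(i := t))) has_real_derivative f' u) (at (u i))) \<and> C_k k n U f')"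

definition smooth_fun :: "nat \<Rightarrow> (nat \<Rightarrow> real) set \<Rightarrow> ((nat \<Rightarrow> real) \<Rightarrow> real) \<Rightarrow> bool" where
  "smooth_fun n U f \<longleftrightarrow> (\<forall>k. C_k k n U f)"

definition smooth_param ::
    "nat \<Rightarrow> (nat \<Rightarrow> real) set \<Rightarrow> nat \<Rightarrow> (nat \<Rightarrow> real) set \<Rightarrow> ((nat \<Rightarrow> real) \<Rightarrow> (nat \<Rightarrow> real)) \<Rightarrow> bool" where
  "smooth_param m W n U h \<longleftrightarrow> h ` W \<subseteq> U \<and> (\<forall>i<n. smooth_fun m W (\<lambda>w. h w i))"

text \<open>A triple \<open>(n, U, p)\<close> in \<open>plots\<close> is a plot \<open>p : U \<rightarrow> pts\<close> with \<open>U\<close> open in \<open>\<real>\<^sup>n\<close>; only the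
  values of \<open>p\<close> on \<open>U\<close> matter.\<close>

record 'a diffsp =
  pts :: "'a set"
  plots :: "(nat \<times> (nat \<Rightarrow> real) set \<times> ((nat \<Rightarrow> real) \<Rightarrow> 'a)) set"

text \<open>The smooth compatibility clause also says (taking \<open>h\<close> the identity) that changing a plot
  outside its domain is harmless.\<close>

definition diffeology :: "'a diffsp \<Rightarrow> bool" where
  "diffeology D \<longleftrightarrow>
     (\<forall>n U p. (n, U, p) \<in> plots D \<longrightarrow> openin (Euclidean_space n) U \<and> p ` U \<subseteq> pts D) \<and>
     (\<forall>n U x. openin (Euclidean_space n) U \<and> x \<in> pts D \<longrightarrow> (n, U, \<lambda>_. x) \<in> plots D) \<and>
     (\<forall>n U p m W h q. (n, U, p) \<in> plots D \<and> openin (Euclidean_space m) W \<and> smooth_param m W n U h \<and>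
        (\<forall>w\<in>W. q w = p (h w)) \<longrightarrow> (m, W, q) \<in> plots D) \<and>
     (\<forall>n U p. openin (Euclidean_space n) U \<and>
        (\<forall>u\<in>U. \<exists>W. u \<in> W \<and> W \<subseteq> U \<and> (n, W, p) \<in> plots D) \<longrightarrow> (n, U, p) \<in> plots D)"

definition dsmooth :: "'a diffsp \<Rightarrow> 'b diffsp \<Rightarrow> ('a \<Rightarrow> 'b) \<Rightarrow> bool" where
  "dsmooth D E \<phi> \<longleftrightarrow> \<phi> ` pts D \<subseteq> pts E \<and>
     (\<forall>n U p. (n, U, p) \<in> plots D \<longrightarrow> (n, U, \<phi> \<circ> p) \<in> plots E)"

definition diffeo :: "'a diffsp \<Rightarrow> 'b diffsp \<Rightarrow> ('a \<Rightarrow> 'b) \<Rightarrow> bool" where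
  "diffeo D E \<phi> \<longleftrightarrow> bij_betw \<phi> (pts D) (pts E) \<and> dsmooth D E \<phi> \<and> dsmooth E D (inv_into (pts D) \<phi>)"

definition D_open :: "'a diffsp \<Rightarrow> 'a set \<Rightarrow> bool" where
  "D_open D W \<longleftrightarrow> W \<subseteq> pts D \<and>
     (\<forall>n U p. (n, U, p) \<in> plots D \<longrightarrow> openin (Euclidean_space n) {u \<in> U. p u \<in> W})"

definition real_sp :: "real diffsp" where
  "real_sp = \<lparr>pts = UNIV, plots = {(n, U, p). openin (Euclidean_space n) U \<and> smooth_fun n U p}\<rparr>"

definition domain_sp :: "nat \<Rightarrow> (nat \<Rightarrow> real) set \<Rightarrow> (nat \<Rightarrow> real) diffsp" where
  "domain_sp n U = \<lparr>pts = U,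
     plots = {(m, W, h). openin (Euclidean_space m) W \<and> smooth_param m W n U h}\<rparr>"

definition subsp :: "'a diffsp \<Rightarrow> 'a set \<Rightarrow> 'a diffsp" where
  "subsp D A = \<lparr>pts = pts D \<inter> A, plots = {(n, U, p) \<in> plots D. p ` U \<subseteq> A}\<rparr>"

definition prod_sp :: "'a diffsp \<Rightarrow> 'b diffsp \<Rightarrow> ('a \<times> 'b) diffsp" where
  "prod_sp D E = \<lparr>pts = pts D \<times> pts E,
     plots = {(n, U, p). (n, U, fst \<circ> p) \<in> plots D \<and> (n, U, snd \<circ> p) \<in> plots E}\<rparr>"

definition sum_sp :: "'a diffsp \<Rightarrow> 'b diffsp \<Rightarrow> ('a + 'b) diffsp" where
  "sum_sp D E = \<lparr>pts = pts D <+> pts E,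
     plots = {(n, U, p). openin (Euclidean_space n) U \<and>
       (\<forall>u\<in>U. \<exists>W. u \<in> W \<and> W \<subseteq> U \<and>
          ((\<exists>q. (n, W, q) \<in> plots D \<and> (\<forall>w\<in>W. p w = Inl (q w))) \<or>
           (\<exists>q. (n, W, q) \<in> plots E \<and> (\<forall>w\<in>W. p w = Inr (q w)))))}\<rparr>"

text \<open>The quotient diffeology, for a map onto its image.\<close>

definition pushforward :: "'a diffsp \<Rightarrow> ('a \<Rightarrow> 'b) \<Rightarrow> 'b diffsp" where
  "pushforward D \<phi> = \<lparr>pts = \<phi> ` pts D,
     plots = {(n, U, p). openin (Euclidean_space n) U \<and>
       (\<forall>u\<in>U. \<exists>W q. u \<in> W \<and> W \<subseteq> U \<and> (n, W, q) \<in> plots D \<and> (\<forall>w\<in>W. p w = \<phi> (q w)))}\<rparr>"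


section \<open>Diffeological vector spaces and pseudo-bundles\<close>

record 'v dvspace =
  space :: "'v diffsp"
  add :: "'v \<Rightarrow> 'v \<Rightarrow> 'v"
  scale :: "real \<Rightarrow> 'v \<Rightarrow> 'v"
  zero :: "'v"

definition vec_space :: "'v dvspace \<Rightarrow> bool" where
  "vec_space E \<longleftrightarrow> (let A = pts (space E) in
     zero E \<in> A \<and>
     (\<forall>v\<in>A. \<forall>w\<in>A. add E v w \<in> A) \<and>
     (\<forall>a. \<forall>v\<in>A. scale E a v \<in> A) \<and>
     (\<forall>u\<in>A. \<forall>v\<in>A. \<forall>w\<in>A. add E (add E u v) w = add E u (add E v w)) \<and>
     (\<forall>v\<in>A. \<forall>w\<in>A. add E v w = add E w v) \<and>
     (\<forall>v\<in>A. add E (zero E) v = v) \<and>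
     (\<forall>v\<in>A. add E v (scale E (-1) v) = zero E) \<and>
     (\<forall>a. \<forall>v\<in>A. \<forall>w\<in>A. scale E a (add E v w) = add E (scale E a v) (scale E a w)) \<and>
     (\<forall>a b. \<forall>v\<in>A. scale E (a + b) v = add E (scale E a v) (scale E b v)) \<and>
     (\<forall>a b. \<forall>v\<in>A. scale E (a * b) v = scale E a (scale E b v)) \<and>
     (\<forall>v\<in>A. scale E 1 v = v))"

definition diff_vec_space :: "'v dvspace \<Rightarrow> bool" where
  "diff_vec_space E \<longleftrightarrow> diffeology (space E) \<and> vec_space E \<and>
     dsmooth (prod_sp (space E) (space E)) (space E) (\<lambda>(v, w). add E v w) \<and>
     dsmooth (prod_sp real_sp (space E)) (space E) (\<lambda>(a, v). scale E a v)"

definition lincomb :: "'v dvspace \<Rightarrow> real list \<Rightarrow> 'v list \<Rightarrow> 'v" where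
  "lincomb E cs bs = foldr (\<lambda>(a, b) s. add E (scale E a b) s) (zip cs bs) (zero E)"

definition is_basis :: "'v dvspace \<Rightarrow> 'v list \<Rightarrow> bool" where
  "is_basis E bs \<longleftrightarrow> set bs \<subseteq> pts (space E) \<and>
     (\<forall>v\<in>pts (space E). \<exists>!cs. length cs = length bs \<and> v = lincomb E cs bs)"

definition fin_dim :: "'v dvspace \<Rightarrow> bool" where
  "fin_dim E \<longleftrightarrow> (\<exists>bs. is_basis E bs)"

definition vdim :: "'v dvspace \<Rightarrow> nat" where
  "vdim E = (THE n. \<exists>bs. is_basis E bs \<and> length bs = n)"

text \<open>\<open>vadd\<close> and \<open>vscale\<close> are only meaningful within a common fibre.\<close>

record ('v, 'x) pbundle =
  tot :: "'v diffsp"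
  base :: "'x diffsp"
  proj :: "'v \<Rightarrow> 'x"
  vadd :: "'v \<Rightarrow> 'v \<Rightarrow> 'v"
  vscale :: "real \<Rightarrow> 'v \<Rightarrow> 'v"
  vzero :: "'x \<Rightarrow> 'v"

definition over :: "('v, 'x) pbundle \<Rightarrow> 'x set \<Rightarrow> 'v set" where
  "over V W = {v \<in> pts (tot V). proj V v \<in> W}"

definition fibre :: "('v, 'x) pbundle \<Rightarrow> 'x \<Rightarrow> 'v set" where
  "fibre V x = over V {x}"

definition fibre_space :: "('v, 'x) pbundle \<Rightarrow> 'x \<Rightarrow> 'v dvspace" where
  "fibre_space V x =
     \<lparr>space = subsp (tot V) (fibre V x), add = vadd V, scale = vscale V, zero = vzero V x\<rparr>"

definition pseudo_bundle :: "('v, 'x) pbundle \<Rightarrow> bool" where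
  "pseudo_bundle V \<longleftrightarrow> diffeology (tot V) \<and> diffeology (base V) \<and>
     dsmooth (tot V) (base V) (proj V) \<and> proj V ` pts (tot V) = pts (base V) \<and>
     (\<forall>x\<in>pts (base V). vec_space (fibre_space V x)) \<and>
     dsmooth (subsp (prod_sp (tot V) (tot V)) {(v, w). proj V v = proj V w}) (tot V) (\<lambda>(v, w). vadd V v w) \<and>
     dsmooth (prod_sp real_sp (tot V)) (tot V) (\<lambda>(a, v). vscale V a v) \<and>
     dsmooth (base V) (tot V) (vzero V)"

definition fin_dim_bundle :: "('v, 'x) pbundle \<Rightarrow> bool" where
  "fin_dim_bundle V \<longleftrightarrow> (\<forall>x\<in>pts (base V). fin_dim (fibre_space V x))"

text \<open>The typical fibre \<open>E\<close> may be taken on the type of the total space, as it is necessarily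
  isomorphic to a fibre of \<open>V\<close>.\<close>

definition locally_trivial :: "('v, 'x) pbundle \<Rightarrow> bool" where
  "locally_trivial V \<longleftrightarrow> (\<forall>x\<in>pts (base V). \<exists>W (E :: 'v dvspace) \<phi>.
     x \<in> W \<and> D_open (base V) W \<and> diff_vec_space E \<and>
     diffeo (subsp (tot V) (over V W)) (prod_sp (subsp (base V) W) (space E)) \<phi> \<and>
     (\<forall>v\<in>over V W. fst (\<phi> v) = proj V v) \<and>
     (\<forall>v\<in>over V W. \<forall>w\<in>over V W. proj V v = proj V w \<longrightarrow>
        snd (\<phi> (vadd V v w)) = add E (snd (\<phi> v)) (snd (\<phi> w))) \<and>
     (\<forall>a. \<forall>v\<in>over V W. snd (\<phi> (vscale V a v)) = scale E a (snd (\<phi> v))))"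

text \<open>The fibre \<open>(\<pi>\<^sup>-\<^sup>1(x))\<^sup>*\<close> consists of pairs \<open>(x, \<xi>)\<close> with \<open>\<xi>\<close> a smooth linear functional, normalised
  to be \<^const>\<open>undefined\<close> off \<open>\<pi>\<^sup>-\<^sup>1(x)\<close>; the tag \<open>x\<close> keeps the fibres disjoint.  For a plot \<open>q\<close> the
  projection to the base is required to be a plot: this is part of the dual being a pseudo-bundle,
  and does not follow from smoothness of the evaluations (consider fibres of dimension zero).\<close>

definition dual_fibre :: "('v, 'x) pbundle \<Rightarrow> 'x \<Rightarrow> ('v \<Rightarrow> real) set" where
  "dual_fibre V x = {\<xi> \<in> extensional (fibre V x).
     dsmooth (space (fibre_space V x)) real_sp \<xi> \<and>
     (\<forall>v\<in>fibre V x. \<forall>w\<in>fibre V x. \<xi> (vadd V v w) = \<xi> v + \<xi> w) \<and>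
     (\<forall>a. \<forall>v\<in>fibre V x. \<xi> (vscale V a v) = a * \<xi> v)}"

definition dual_sp :: "('v, 'x) pbundle \<Rightarrow> ('x \<times> ('v \<Rightarrow> real)) diffsp" where
  "dual_sp V = \<lparr>pts = (SIGMA x : pts (base V). dual_fibre V x),
     plots = {(m, U', q). openin (Euclidean_space m) U' \<and>
       q ` U' \<subseteq> (SIGMA x : pts (base V). dual_fibre V x) \<and>
       (m, U', fst \<circ> q) \<in> plots (base V) \<and>
       (\<forall>n U p. (n, U, p) \<in> plots (tot V) \<longrightarrow>
          dsmooth (subsp (prod_sp (domain_sp m U') (domain_sp n U)) {(u', u). fst (q u') = proj V (p u)})
            real_sp (\<lambda>(u', u). snd (q u') (p u)))}\<rparr>"

definition dual :: "('v, 'x) pbundle \<Rightarrow> ('x \<times> ('v \<Rightarrow> real), 'x) pbundle" where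
  "dual V = \<lparr>tot = dual_sp V, base = base V, proj = fst,
     vadd = (\<lambda>(x, \<xi>) (_, \<eta>). (x, \<lambda>v\<in>fibre V x. \<xi> v + \<eta> v)),
     vscale = (\<lambda>a (x, \<xi>). (x, \<lambda>v\<in>fibre V x. a * \<xi> v)),
     vzero = (\<lambda>x. (x, \<lambda>v\<in>fibre V x. 0))\<rparr>"

text \<open>The direct sum of the bundles \<open>B 0, \<dots>, B k\<close> over a common base: tuples of vectors lying over
  the same point, with the subset diffeology of the product.\<close>

definition dsum :: "nat \<Rightarrow> (nat \<Rightarrow> ('v, 'x) pbundle) \<Rightarrow> (nat \<Rightarrow> 'v, 'x) pbundle" where
  "dsum k B =
     (let A = {s \<in> (\<Pi>\<^sub>E n\<in>{..k}. pts (tot (B n))). \<forall>n\<le>k. proj (B n) (s n) = proj (B 0) (s 0)} in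
     \<lparr>tot = \<lparr>pts = A, plots = {(m, U, p). openin (Euclidean_space m) U \<and> p ` U \<subseteq> A \<and>
        (\<forall>n\<le>k. (m, U, \<lambda>u. p u n) \<in> plots (tot (B n)))}\<rparr>,
      base = base (B 0), proj = (\<lambda>s. proj (B 0) (s 0)),
      vadd = (\<lambda>s s'. \<lambda>n\<in>{..k}. vadd (B n) (s n) (s' n)),
      vscale = (\<lambda>a s. \<lambda>n\<in>{..k}. vscale (B n) a (s n)),
      vzero = (\<lambda>x. \<lambda>n\<in>{..k}. vzero (B n) x)\<rparr>)"

definition dsum_map :: "nat \<Rightarrow> (nat \<Rightarrow> 'v \<Rightarrow> 'w) \<Rightarrow> (nat \<Rightarrow> 'v) \<Rightarrow> (nat \<Rightarrow> 'w)" where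
  "dsum_map k \<Phi> s = (\<lambda>n\<in>{..k}. \<Phi> n (s n))"


section \<open>Tensor powers\<close>

text \<open>Tensors are cosets in the free real vector space on words (lists) of vectors.\<close>

instantiation poly_mapping :: (type, real_vector) real_vector
begin

definition scaleR_poly_mapping :: "real \<Rightarrow> ('a \<Rightarrow>\<^sub>0 'b) \<Rightarrow> ('a \<Rightarrow>\<^sub>0 'b)" where
  "scaleR_poly_mapping a t = Poly_Mapping.map (scaleR a) t"

lemma lookup_scaleR [simp]:
  "Poly_Mapping.lookup (a *\<^sub>R t) k = a *\<^sub>R Poly_Mapping.lookup (t :: 'a \<Rightarrow>\<^sub>0 'b) k"
  by (simp add: scaleR_poly_mapping_def Poly_Mapping.map.rep_eq when_def)

instance
  by standard (auto intro!: poly_mapping_eqI simp: lookup_add algebra_simps)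

end

type_synonym 'v words = "'v list \<Rightarrow>\<^sub>0 real"

definition word :: "'v list \<Rightarrow> 'v words" where
  "word ws = Poly_Mapping.single ws 1"

definition lin_ext :: "('a \<Rightarrow> 'b::real_vector) \<Rightarrow> ('a \<Rightarrow>\<^sub>0 real) \<Rightarrow> 'b" where
  "lin_ext \<phi> t = (\<Sum>ws\<in>Poly_Mapping.keys t. Poly_Mapping.lookup t ws *\<^sub>R \<phi> ws)"

definition coset :: "'a::real_vector set \<Rightarrow> 'a \<Rightarrow> 'a set" where
  "coset R t = {s. s - t \<in> span R}"

text \<open>The span of \<open>multilin V x\<close> is a two-sided ideal of the free algebra on the set \<open>\<pi>\<^sup>-\<^sup>1(x)\<close>, and the
  quotient is the tensor algebra of \<open>\<pi>\<^sup>-\<^sup>1(x)\<close>.\<close>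

definition multilin :: "('v, 'x) pbundle \<Rightarrow> 'x \<Rightarrow> 'v words set" where
  "multilin V x =
     {word (us @ [vadd V v w] @ vs) - word (us @ [v] @ vs) - word (us @ [w] @ vs) | us vs v w.
        us \<in> lists (fibre V x) \<and> vs \<in> lists (fibre V x) \<and> v \<in> fibre V x \<and> w \<in> fibre V x} \<union>
     {word (us @ [vscale V a v] @ vs) - a *\<^sub>R word (us @ [v] @ vs) | us vs v a.
        us \<in> lists (fibre V x) \<and> vs \<in> lists (fibre V x) \<and> v \<in> fibre V x}"

text \<open>A bundle with elements \<open>(x, c)\<close>, \<open>c\<close> a coset of \<open>span (R x)\<close>.  Operations are defined on
  representatives; the cosets over which the unions below range all coincide.\<close>

definition quot_bundle ::
    "'x diffsp \<Rightarrow> ('x \<Rightarrow> 'v words set) \<Rightarrow> ('x \<times> 'v words set) diffsp \<Rightarrow> ('x \<times> 'v words set, 'x) pbundle" where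
  "quot_bundle X R D = \<lparr>tot = D, base = X, proj = fst,
     vadd = (\<lambda>(x, c) (_, d). (x, \<Union>s\<in>c. \<Union>t\<in>d. coset (R x) (s + t))),
     vscale = (\<lambda>a (x, c). (x, \<Union>t\<in>c. coset (R x) (a *\<^sub>R t))),
     vzero = (\<lambda>x. (x, coset (R x) 0))\<rparr>"

text \<open>The \<open>n\<close>-fold fibre product \<open>V \<times>\<^sub>X \<dots> \<times>\<^sub>X V\<close>; the base point is recorded for the sake of \<open>n = 0\<close>.\<close>

definition fibre_power :: "nat \<Rightarrow> ('v, 'x) pbundle \<Rightarrow> ('x \<times> 'v list) diffsp" where
  "fibre_power n V =
     (let A = {(x, ws). x \<in> pts (base V) \<and> ws \<in> lists (fibre V x) \<and> length ws = n} in
     \<lparr>pts = A, plots = {(m, U, p). p ` U \<subseteq> A \<and> (m, U, fst \<circ> p) \<in> plots (base V) \<and>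
        (\<forall>i<n. (m, U, \<lambda>u. snd (p u) ! i) \<in> plots (tot V))}\<rparr>)"

text \<open>The \<open>n\<close>-th tensor power \<open>V\<^sup>\<otimes>\<^sup>n\<close>, realised as the degree \<open>n\<close> part of the tensor algebra so that all
  degrees have the same type.  It carries the finest pseudo-bundle diffeology for which the
  canonical map from the \<open>n\<close>-fold fibre product is smooth (the admissible diffeologies are closed
  under intersection).\<close>

definition tpow_pts :: "nat \<Rightarrow> ('v, 'x) pbundle \<Rightarrow> ('x \<times> 'v words set) set" where
  "tpow_pts n V = {(x, coset (multilin V x) t) | x t. x \<in> pts (base V) \<and>
     Poly_Mapping.keys t \<subseteq> {ws \<in> lists (fibre V x). length ws = n}}"

definition tpow_sp :: "nat \<Rightarrow> ('v, 'x) pbundle \<Rightarrow> ('x \<times> 'v words set) diffsp" where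
  "tpow_sp n V = \<lparr>pts = tpow_pts n V,
     plots = {(m, U, p). \<forall>D. pts D = tpow_pts n V \<and>
        pseudo_bundle (quot_bundle (base V) (multilin V) D) \<and>
        dsmooth (fibre_power n V) D (\<lambda>(x, ws). (x, coset (multilin V x) (word ws))) \<longrightarrow>
        (m, U, p) \<in> plots D}\<rparr>"

definition tpow :: "nat \<Rightarrow> ('v, 'x) pbundle \<Rightarrow> ('x \<times> 'v words set, 'x) pbundle" where
  "tpow n V = quot_bundle (base V) (multilin V) (tpow_sp n V)"

text \<open>The map on word cosets induced by a fibrewise linear map \<open>\<phi>\<close> over \<open>f\<close>, i.e.
  \<open>v\<^sub>1 \<otimes> \<dots> \<otimes> v\<^sub>n \<mapsto> \<phi>(v\<^sub>1) \<otimes> \<dots> \<otimes> \<phi>(v\<^sub>n)\<close>; \<open>R'\<close> are the relations in the target.\<close>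

definition word_map ::
    "('y \<Rightarrow> 'w words set) \<Rightarrow> ('x \<Rightarrow> 'y) \<Rightarrow> ('v \<Rightarrow> 'w) \<Rightarrow> 'x \<times> 'v words set \<Rightarrow> 'y \<times> 'w words set" where
  "word_map R' f \<phi> = (\<lambda>(x, c). (f x, \<Union>t\<in>c. coset (R' (f x)) (lin_ext (\<lambda>ws. word (map \<phi> ws)) t)))"


section \<open>Pseudo-metrics\<close>

text \<open>The value on \<open>v, w\<close> of the bilinear form given by an element of \<open>V\<^sup>* \<otimes> V\<^sup>*\<close> with representative
  \<open>t\<close>; words of length other than 2 only occur in \<open>t\<close> through a summand in the span of the
  multilinearity relations.\<close>

definition form_value :: "('x \<times> ('v \<Rightarrow> real)) words \<Rightarrow> 'v \<Rightarrow> 'v \<Rightarrow> real" where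
  "form_value t v w = lin_ext (\<lambda>ws. case ws of [\<xi>, \<eta>] \<Rightarrow> snd \<xi> v * snd \<eta> w | _ \<Rightarrow> 0) t"

text \<open>A pseudo-metric is given through its bilinear forms \<open>g x\<close> (meaningful on \<open>\<pi>\<^sup>-\<^sup>1(x)\<close> only), which
  are the values of a smooth section of \<open>V\<^sup>* \<otimes> V\<^sup>*\<close>.  The rank of \<open>g x\<close> is the dimension of
  the space of functionals \<open>g x v\<close>.\<close>

definition pseudo_metric :: "('v, 'x) pbundle \<Rightarrow> ('x \<Rightarrow> 'v \<Rightarrow> 'v \<Rightarrow> real) \<Rightarrow> bool" where
  "pseudo_metric V g \<longleftrightarrow>
     (\<exists>s. dsmooth (base V) (tot (tpow 2 (dual V))) s \<and>
        (\<forall>x\<in>pts (base V). fst (s x) = x \<and>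
           (\<forall>t\<in>snd (s x). \<forall>v\<in>fibre V x. \<forall>w\<in>fibre V x. g x v w = form_value t v w))) \<and>
     (\<forall>x\<in>pts (base V).
        (\<forall>v\<in>fibre V x. \<forall>w\<in>fibre V x. g x v w = g x w v) \<and>
        (\<forall>v\<in>fibre V x. 0 \<le> g x v v) \<and>
        vdim ((fibre_space (dual V) x)
              \<lparr>space := subsp (tot (dual V)) ((\<lambda>v. (x, restrict (g x v) (fibre V x))) ` fibre V x)\<rparr>)
          = vdim (fibre_space (dual V) x))"


section \<open>Gluing\<close>

definition glue_rel :: "'a set \<Rightarrow> 'b set \<Rightarrow> 'a set \<Rightarrow> ('a \<Rightarrow> 'b) \<Rightarrow> (('a + 'b) \<times> ('a + 'b)) set" where
  "glue_rel A B Z h = {(a, b). a \<in> A <+> B \<and> b \<in> A <+> B \<and>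
     equivclp (\<lambda>a b. \<exists>z\<in>Z. a = Inl z \<and> b = Inr (h z)) a b}"

definition glue_class :: "'a diffsp \<Rightarrow> 'b diffsp \<Rightarrow> 'a set \<Rightarrow> ('a \<Rightarrow> 'b) \<Rightarrow> 'a + 'b \<Rightarrow> ('a + 'b) set" where
  "glue_class D E Z h a = glue_rel (pts D) (pts E) Z h `` {a}"

definition glue_sp :: "'a diffsp \<Rightarrow> 'b diffsp \<Rightarrow> 'a set \<Rightarrow> ('a \<Rightarrow> 'b) \<Rightarrow> ('a + 'b) set diffsp" where
  "glue_sp D E Z h = pushforward (sum_sp D E) (glue_class D E Z h)"

definition incl1 :: "'a diffsp \<Rightarrow> 'b diffsp \<Rightarrow> 'a set \<Rightarrow> ('a \<Rightarrow> 'b) \<Rightarrow> 'a \<Rightarrow> ('a + 'b) set" where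
  "incl1 D E Z h a = glue_class D E Z h (Inl a)"

definition incl2 :: "'a diffsp \<Rightarrow> 'b diffsp \<Rightarrow> 'a set \<Rightarrow> ('a \<Rightarrow> 'b) \<Rightarrow> 'b \<Rightarrow> ('a + 'b) set" where
  "incl2 D E Z h b = glue_class D E Z h (Inr b)"

text \<open>A class either contains exactly one \<open>Inr b\<close>, and is then the image of \<open>b\<close> under the second
  inclusion, or is of the form \<open>{Inl a}\<close> with \<open>a\<close> outside the gluing domain, and is then the image
  of \<open>a\<close> under the first.  Accordingly \<open>out1\<close> and \<open>out2\<close> are the inverses of the natural inclusions,
  and \<open>glue_case\<close> defines a function by distinguishing their disjoint images.\<close>

definition out1 :: "('a + 'b) set \<Rightarrow> 'a" where
  "out1 c = (THE a. Inl a \<in> c)"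

definition out2 :: "('a + 'b) set \<Rightarrow> 'b" where
  "out2 c = (THE b. Inr b \<in> c)"

definition glue_case :: "('a \<Rightarrow> 'r) \<Rightarrow> ('b \<Rightarrow> 'r) \<Rightarrow> ('a + 'b) set \<Rightarrow> 'r" where
  "glue_case F G c = (if \<exists>b. Inr b \<in> c then G (out2 c) else F (out1 c))"

abbreviation base_incl1 ("i\<^sub>1") where "i\<^sub>1 V\<^sub>1 V\<^sub>2 Y f \<equiv> incl1 (base V\<^sub>1) (base V\<^sub>2) Y f"
abbreviation base_incl2 ("i\<^sub>2") where "i\<^sub>2 V\<^sub>1 V\<^sub>2 Y f \<equiv> incl2 (base V\<^sub>1) (base V\<^sub>2) Y f"
abbreviation tot_incl1 ("j\<^sub>1") where "j\<^sub>1 V\<^sub>1 V\<^sub>2 Y h \<equiv> incl1 (tot V\<^sub>1) (tot V\<^sub>2) (over V\<^sub>1 Y) h"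
abbreviation tot_incl2 ("j\<^sub>2") where "j\<^sub>2 V\<^sub>1 V\<^sub>2 Y h \<equiv> incl2 (tot V\<^sub>1) (tot V\<^sub>2) (over V\<^sub>1 Y) h"

text \<open>In the fibre over a point of \<open>i\<^sub>2(X\<^sub>2)\<close> every vector is in the image of \<open>j\<^sub>2\<close>, and over
  \<open>i\<^sub>1(X\<^sub>1 - Y)\<close> every vector is in the image of \<open>j\<^sub>1\<close>.\<close>

definition glue ::
    "('v, 'x) pbundle \<Rightarrow> ('w, 'y) pbundle \<Rightarrow> 'x set \<Rightarrow> ('x \<Rightarrow> 'y) \<Rightarrow> ('v \<Rightarrow> 'w) \<Rightarrow> (('v + 'w) set, ('x + 'y) set) pbundle" where
  "glue V\<^sub>1 V\<^sub>2 Y f h = \<lparr>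
     tot = glue_sp (tot V\<^sub>1) (tot V\<^sub>2) (over V\<^sub>1 Y) h,
     base = glue_sp (base V\<^sub>1) (base V\<^sub>2) Y f,
     proj = glue_case (i\<^sub>1 V\<^sub>1 V\<^sub>2 Y f \<circ> proj V\<^sub>1) (i\<^sub>2 V\<^sub>1 V\<^sub>2 Y f \<circ> proj V\<^sub>2),
     vadd = (\<lambda>c d. glue_case (\<lambda>v. j\<^sub>1 V\<^sub>1 V\<^sub>2 Y h (vadd V\<^sub>1 v (out1 d)))
                             (\<lambda>v. j\<^sub>2 V\<^sub>1 V\<^sub>2 Y h (vadd V\<^sub>2 v (out2 d))) c),
     vscale = (\<lambda>a. glue_case (\<lambda>v. j\<^sub>1 V\<^sub>1 V\<^sub>2 Y h (vscale V\<^sub>1 a v)) (\<lambda>v. j\<^sub>2 V\<^sub>1 V\<^sub>2 Y h (vscale V\<^sub>2 a v))),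
     vzero = glue_case (j\<^sub>1 V\<^sub>1 V\<^sub>2 Y h \<circ> vzero V\<^sub>1) (j\<^sub>2 V\<^sub>1 V\<^sub>2 Y h \<circ> vzero V\<^sub>2)\<rparr>"

definition gluing ::
    "('v, 'x) pbundle \<Rightarrow> ('w, 'y) pbundle \<Rightarrow> 'x set \<Rightarrow> ('x \<Rightarrow> 'y) \<Rightarrow> ('v \<Rightarrow> 'w) \<Rightarrow> bool" where
  "gluing V\<^sub>1 V\<^sub>2 Y f h \<longleftrightarrow> Y \<subseteq> pts (base V\<^sub>1) \<and>
     dsmooth (subsp (base V\<^sub>1) Y) (base V\<^sub>2) f \<and>
     dsmooth (subsp (tot V\<^sub>1) (over V\<^sub>1 Y)) (tot V\<^sub>2) h \<and>
     (\<forall>v\<in>over V\<^sub>1 Y. proj V\<^sub>2 (h v) = f (proj V\<^sub>1 v)) \<and>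
     (\<forall>y\<in>Y. \<forall>v\<in>fibre V\<^sub>1 y. \<forall>w\<in>fibre V\<^sub>1 y. h (vadd V\<^sub>1 v w) = vadd V\<^sub>2 (h v) (h w)) \<and>
     (\<forall>y\<in>Y. \<forall>a. \<forall>v\<in>fibre V\<^sub>1 y. h (vscale V\<^sub>1 a v) = vscale V\<^sub>2 a (h v))"

text \<open>Meaningful for \<open>f\<close> injective on \<open>Y\<close>.\<close>

definition dual_map ::
    "('v, 'x) pbundle \<Rightarrow> 'x set \<Rightarrow> ('x \<Rightarrow> 'y) \<Rightarrow> ('v \<Rightarrow> 'w) \<Rightarrow> 'y \<times> ('w \<Rightarrow> real) \<Rightarrow> 'x \<times> ('v \<Rightarrow> real)" where
  "dual_map V\<^sub>1 Y f h = (\<lambda>(x, \<xi>). let y = inv_into Y f x in (y, \<lambda>v\<in>fibre V\<^sub>1 y. \<xi> (h v)))"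

definition diffeo_onto_image :: "'a diffsp \<Rightarrow> 'b diffsp \<Rightarrow> 'a set \<Rightarrow> ('a \<Rightarrow> 'b) \<Rightarrow> bool" where
  "diffeo_onto_image D E A \<phi> \<longleftrightarrow> diffeo (subsp D A) (subsp E (\<phi> ` A)) \<phi>"

definition compatible_metrics ::
    "('v, 'x) pbundle \<Rightarrow> 'x set \<Rightarrow> ('x \<Rightarrow> 'y) \<Rightarrow> ('v \<Rightarrow> 'w) \<Rightarrow> ('x \<Rightarrow> 'v \<Rightarrow> 'v \<Rightarrow> real) \<Rightarrow> ('y \<Rightarrow> 'w \<Rightarrow> 'w \<Rightarrow> real) \<Rightarrow> bool" where
  "compatible_metrics V\<^sub>1 Y f h g\<^sub>1 g\<^sub>2 \<longleftrightarrow>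
     (\<forall>y\<in>Y. \<forall>v\<in>fibre V\<^sub>1 y. \<forall>w\<in>fibre V\<^sub>1 y. g\<^sub>1 y v w = g\<^sub>2 (f y) (h v) (h w))"

definition glue_metric ::
    "('x \<Rightarrow> 'v \<Rightarrow> 'v \<Rightarrow> real) \<Rightarrow> ('y \<Rightarrow> 'w \<Rightarrow> 'w \<Rightarrow> real) \<Rightarrow>
     ('x + 'y) set \<Rightarrow> ('v + 'w) set \<Rightarrow> ('v + 'w) set \<Rightarrow> real" where
  "glue_metric g\<^sub>1 g\<^sub>2 x v w = glue_case (\<lambda>x\<^sub>1. g\<^sub>1 x\<^sub>1 (out1 v) (out1 w)) (\<lambda>x\<^sub>2. g\<^sub>2 x\<^sub>2 (out2 v) (out2 w)) x"

definition fibre_dims :: "('v, 'x) pbundle \<Rightarrow> nat set" where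
  "fibre_dims V = (\<lambda>x. vdim (fibre_space V x)) ` pts (base V)"

definition dim_V :: "('v, 'x) pbundle \<Rightarrow> ('w, 'y) pbundle \<Rightarrow> nat" where
  "dim_V V\<^sub>1 V\<^sub>2 = Sup (fibre_dims V\<^sub>1 \<union> fibre_dims V\<^sub>2)"


section \<open>Clifford algebras\<close>

text \<open>The relations are multiplied by arbitrary words on both sides, so that the span of
  \<open>clifford_rel V g x\<close> is the two-sided ideal.  The quotient of the free algebra by it is the
  quotient of the tensor algebra by the ideal generated by \<open>v \<otimes> w + w \<otimes> v + 2 g(x)(v,w)\<close>.\<close>

definition clifford_rel ::
    "('v, 'x) pbundle \<Rightarrow> ('x \<Rightarrow> 'v \<Rightarrow> 'v \<Rightarrow> real) \<Rightarrow> 'x \<Rightarrow> 'v words set" where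
  "clifford_rel V g x = multilin V x \<union>
     {word (us @ [v, w] @ vs) + word (us @ [w, v] @ vs) + (2 * g x v w) *\<^sub>R word (us @ vs) | us vs v w.
        us \<in> lists (fibre V x) \<and> vs \<in> lists (fibre V x) \<and> v \<in> fibre V x \<and> w \<in> fibre V x}"

text \<open>The quotient projection from \<open>V\<^sup>\<otimes>\<^sup>0 \<oplus> \<dots> \<oplus> V\<^sup>\<otimes>\<^sup>N\<close>; the quotient diffeology is formed with respect
  to all these partial sums of the tensor algebra.\<close>

definition clifford_proj ::
    "('v, 'x) pbundle \<Rightarrow> ('x \<Rightarrow> 'v \<Rightarrow> 'v \<Rightarrow> real) \<Rightarrow> nat \<Rightarrow> (nat \<Rightarrow> 'x \<times> 'v words set) \<Rightarrow> 'x \<times> 'v words set" where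
  "clifford_proj V g N s = (let x = fst (s 0) in
     (x, \<Union>t\<in>{t. \<forall>n\<le>N. t n \<in> snd (s n)}. coset (clifford_rel V g x) (\<Sum>n\<le>N. t n)))"

definition clifford_sp ::
    "('v, 'x) pbundle \<Rightarrow> ('x \<Rightarrow> 'v \<Rightarrow> 'v \<Rightarrow> real) \<Rightarrow> ('x \<times> 'v words set) diffsp" where
  "clifford_sp V g = \<lparr>
     pts = {(x, coset (clifford_rel V g x) t) | x t.
              x \<in> pts (base V) \<and> Poly_Mapping.keys t \<subseteq> lists (fibre V x)},
     plots = {(m, U, p). openin (Euclidean_space m) U \<and>
       (\<forall>u\<in>U. \<exists>W N q. u \<in> W \<and> W \<subseteq> U \<and> (m, W, q) \<in> plots (tot (dsum N (\<lambda>n. tpow n V))) \<and>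
          (\<forall>w\<in>W. p w = clifford_proj V g N (q w)))}\<rparr>"

definition clifford ::
    "('v, 'x) pbundle \<Rightarrow> ('x \<Rightarrow> 'v \<Rightarrow> 'v \<Rightarrow> real) \<Rightarrow> ('x \<times> 'v words set, 'x) pbundle" where
  "clifford V g = quot_bundle (base V) (clifford_rel V g) (clifford_sp V g)"

definition clifford_mult ::
    "('v, 'x) pbundle \<Rightarrow> ('x \<Rightarrow> 'v \<Rightarrow> 'v \<Rightarrow> real) \<Rightarrow>
     'x \<times> 'v words set \<Rightarrow> 'x \<times> 'v words set \<Rightarrow> 'x \<times> 'v words set" where
  "clifford_mult V g = (\<lambda>(x, c) (_, d).
     (x, \<Union>s\<in>c. \<Union>t\<in>d. coset (clifford_rel V g x) (lin_ext (\<lambda>us. lin_ext (\<lambda>vs. word (us @ vs)) t) s)))"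

definition clifford_word ::
    "('v, 'x) pbundle \<Rightarrow> ('x \<Rightarrow> 'v \<Rightarrow> 'v \<Rightarrow> real) \<Rightarrow> 'x \<Rightarrow> 'v list \<Rightarrow> 'x \<times> 'v words set" where
  "clifford_word V g x ws = (x, coset (clifford_rel V g x) (word ws))"

definition F_Cl ::
    "('w, 'y) pbundle \<Rightarrow> ('y \<Rightarrow> 'w \<Rightarrow> 'w \<Rightarrow> real) \<Rightarrow> ('x \<Rightarrow> 'y) \<Rightarrow> ('v \<Rightarrow> 'w) \<Rightarrow>
     'x \<times> 'v words set \<Rightarrow> 'y \<times> 'w words set" where
  "F_Cl V\<^sub>2 g\<^sub>2 f h = word_map (clifford_rel V\<^sub>2 g\<^sub>2) f h"

definition glue_clifford ::
    "('v, 'x) pbundle \<Rightarrow> ('w, 'y) pbundle \<Rightarrow> 'x set \<Rightarrow> ('x \<Rightarrow> 'y) \<Rightarrow> ('v \<Rightarrow> 'w) \<Rightarrow>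
     ('x \<Rightarrow> 'v \<Rightarrow> 'v \<Rightarrow> real) \<Rightarrow> ('y \<Rightarrow> 'w \<Rightarrow> 'w \<Rightarrow> real) \<Rightarrow>
     (('x \<times> 'v words set + 'y \<times> 'w words set) set, ('x + 'y) set) pbundle" where
  "glue_clifford V\<^sub>1 V\<^sub>2 Y f h g\<^sub>1 g\<^sub>2 = glue (clifford V\<^sub>1 g\<^sub>1) (clifford V\<^sub>2 g\<^sub>2) Y f (F_Cl V\<^sub>2 g\<^sub>2 f h)"

definition Phi_Cl ::
    "('v, 'x) pbundle \<Rightarrow> ('w, 'y) pbundle \<Rightarrow> 'x set \<Rightarrow> ('x \<Rightarrow> 'y) \<Rightarrow> ('v \<Rightarrow> 'w) \<Rightarrow>
     ('x \<Rightarrow> 'v \<Rightarrow> 'v \<Rightarrow> real) \<Rightarrow> ('y \<Rightarrow> 'w \<Rightarrow> 'w \<Rightarrow> real) \<Rightarrow>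
     ('x \<times> 'v words set + 'y \<times> 'w words set) set \<Rightarrow> ('x + 'y) set \<times> ('v + 'w) set words set" where
  "Phi_Cl V\<^sub>1 V\<^sub>2 Y f h g\<^sub>1 g\<^sub>2 =
     (let R = clifford_rel (glue V\<^sub>1 V\<^sub>2 Y f h) (glue_metric g\<^sub>1 g\<^sub>2) in
      glue_case (word_map R (i\<^sub>1 V\<^sub>1 V\<^sub>2 Y f) (j\<^sub>1 V\<^sub>1 V\<^sub>2 Y h)) (word_map R (i\<^sub>2 V\<^sub>1 V\<^sub>2 Y f) (j\<^sub>2 V\<^sub>1 V\<^sub>2 Y h)))"


section \<open>Exterior algebras\<close>

definition alt :: "'v words \<Rightarrow> 'v words" where
  "alt = lin_ext (\<lambda>ws. (1 / fact (length ws)) *\<^sub>R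
     (\<Sum>\<sigma> | \<sigma> permutes {..<length ws}. of_int (sign \<sigma>) *\<^sub>R word (permute_list \<sigma> ws)))"

definition Alt :: "('v, 'x) pbundle \<Rightarrow> 'x \<times> 'v words set \<Rightarrow> 'x \<times> 'v words set" where
  "Alt V = (\<lambda>(x, c). (x, \<Union>t\<in>c. coset (multilin V x) (alt t)))"

definition ext_pow :: "nat \<Rightarrow> ('v, 'x) pbundle \<Rightarrow> ('x \<times> 'v words set, 'x) pbundle" where
  "ext_pow n V = (tpow n V)\<lparr>tot := subsp (tot (tpow n V)) (Alt V ` pts (tot (tpow n V)))\<rparr>"

text \<open>The exterior algebra bundle; \<open>k\<close> is a bound for the dimensions of the fibres.\<close>

definition ext :: "nat \<Rightarrow> ('v, 'x) pbundle \<Rightarrow> (nat \<Rightarrow> 'x \<times> 'v words set, 'x) pbundle" where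
  "ext k V = dsum k (\<lambda>n. ext_pow n V)"

text \<open>\<open>wedge k V x (word [v\<^sub>1, \<dots>, v\<^sub>n])\<close> is \<open>v\<^sub>1 \<and> \<dots> \<and> v\<^sub>n\<close>, placed in degree \<open>n\<close> (it is \<open>0\<close> for \<open>n > k\<close>);
  the definition extends this linearly to combinations of words.\<close>

definition wedge :: "nat \<Rightarrow> ('v, 'x) pbundle \<Rightarrow> 'x \<Rightarrow> 'v words \<Rightarrow> (nat \<Rightarrow> 'x \<times> 'v words set)" where
  "wedge k V x t = (\<lambda>n\<in>{..k}.
     Alt V (x, coset (multilin V x) (lin_ext (\<lambda>ws. if length ws = n then word ws else 0) t)))"

definition tensor_sum_map ::
    "nat \<Rightarrow> ('w, 'y) pbundle \<Rightarrow> ('x \<Rightarrow> 'y) \<Rightarrow> ('v \<Rightarrow> 'w) \<Rightarrow>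
     (nat \<Rightarrow> 'x \<times> 'v words set) \<Rightarrow> (nat \<Rightarrow> 'y \<times> 'w words set)" where
  "tensor_sum_map k V\<^sub>2 f h = dsum_map k (\<lambda>n. word_map (multilin V\<^sub>2) f h)"

definition glue_tpow ::
    "nat \<Rightarrow> ('v, 'x) pbundle \<Rightarrow> ('w, 'y) pbundle \<Rightarrow> 'x set \<Rightarrow> ('x \<Rightarrow> 'y) \<Rightarrow> ('v \<Rightarrow> 'w) \<Rightarrow>
     (('x \<times> 'v words set + 'y \<times> 'w words set) set, ('x + 'y) set) pbundle" where
  "glue_tpow n V\<^sub>1 V\<^sub>2 Y f h = glue (tpow n V\<^sub>1) (tpow n V\<^sub>2) Y f (word_map (multilin V\<^sub>2) f h)"

definition glue_ext ::
    "nat \<Rightarrow> ('v, 'x) pbundle \<Rightarrow> ('w, 'y) pbundle \<Rightarrow> 'x set \<Rightarrow> ('x \<Rightarrow> 'y) \<Rightarrow> ('v \<Rightarrow> 'w) \<Rightarrow>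
     (((nat \<Rightarrow> 'x \<times> 'v words set) + (nat \<Rightarrow> 'y \<times> 'w words set)) set, ('x + 'y) set) pbundle" where
  "glue_ext k V\<^sub>1 V\<^sub>2 Y f h = glue (ext k V\<^sub>1) (ext k V\<^sub>2) Y f (tensor_sum_map k V\<^sub>2 f h)"

definition Phi_tensor ::
    "nat \<Rightarrow> ('v, 'x) pbundle \<Rightarrow> ('w, 'y) pbundle \<Rightarrow> 'x set \<Rightarrow> ('x \<Rightarrow> 'y) \<Rightarrow> ('v \<Rightarrow> 'w) \<Rightarrow>
     ('x + 'y) set \<times> ('v + 'w) set words set \<Rightarrow> ('x \<times> 'v words set + 'y \<times> 'w words set) set" where
  "Phi_tensor n V\<^sub>1 V\<^sub>2 Y f h t =
     (let R = multilin (glue V\<^sub>1 V\<^sub>2 Y f h);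
          T\<^sub>1 = tpow n V\<^sub>1; T\<^sub>2 = tpow n V\<^sub>2; H = word_map (multilin V\<^sub>2) f h in
      glue_case
        (\<lambda>x. j\<^sub>1 T\<^sub>1 T\<^sub>2 Y H (inv_into (fibre T\<^sub>1 x) (word_map R (i\<^sub>1 V\<^sub>1 V\<^sub>2 Y f) (j\<^sub>1 V\<^sub>1 V\<^sub>2 Y h)) t))
        (\<lambda>x. j\<^sub>2 T\<^sub>1 T\<^sub>2 Y H (inv_into (fibre T\<^sub>2 x) (word_map R (i\<^sub>2 V\<^sub>1 V\<^sub>2 Y f) (j\<^sub>2 V\<^sub>1 V\<^sub>2 Y h)) t))
        (fst t))"

definition Phi_sum ::
    "nat \<Rightarrow> ('v, 'x) pbundle \<Rightarrow> ('w, 'y) pbundle \<Rightarrow> 'x set \<Rightarrow> ('x \<Rightarrow> 'y) \<Rightarrow> ('v \<Rightarrow> 'w) \<Rightarrow>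
     (nat \<Rightarrow> ('x \<times> 'v words set + 'y \<times> 'w words set) set) \<Rightarrow>
     ((nat \<Rightarrow> 'x \<times> 'v words set) + (nat \<Rightarrow> 'y \<times> 'w words set)) set" where
  "Phi_sum k V\<^sub>1 V\<^sub>2 Y f h s =
     (let S\<^sub>1 = dsum k (\<lambda>n. tpow n V\<^sub>1); S\<^sub>2 = dsum k (\<lambda>n. tpow n V\<^sub>2);
          H = word_map (multilin V\<^sub>2) f h in
      glue_case
        (\<lambda>x. j\<^sub>1 S\<^sub>1 S\<^sub>2 Y (tensor_sum_map k V\<^sub>2 f h)
          (inv_into (fibre S\<^sub>1 x) (dsum_map k (\<lambda>n. j\<^sub>1 (tpow n V\<^sub>1) (tpow n V\<^sub>2) Y H)) s))
        (\<lambda>x. j\<^sub>2 S\<^sub>1 S\<^sub>2 Y (tensor_sum_map k V\<^sub>2 f h)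
          (inv_into (fibre S\<^sub>2 x) (dsum_map k (\<lambda>n. j\<^sub>2 (tpow n V\<^sub>1) (tpow n V\<^sub>2) Y H)) s))
        (proj (dsum k (\<lambda>n. glue_tpow n V\<^sub>1 V\<^sub>2 Y f h)) s))"

text \<open>The final \<open>glue_case\<close> is the corestriction: it re-reads an element of the gluing of the sums of
  tensor powers as an element of the gluing of the exterior algebras (the former is a larger class
  of the same representative).\<close>

definition Phi_ext ::
    "nat \<Rightarrow> ('v, 'x) pbundle \<Rightarrow> ('w, 'y) pbundle \<Rightarrow> 'x set \<Rightarrow> ('x \<Rightarrow> 'y) \<Rightarrow> ('v \<Rightarrow> 'w) \<Rightarrow>
     (nat \<Rightarrow> ('x + 'y) set \<times> ('v + 'w) set words set) \<Rightarrow>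
     ((nat \<Rightarrow> 'x \<times> 'v words set) + (nat \<Rightarrow> 'y \<times> 'w words set)) set" where
  "Phi_ext k V\<^sub>1 V\<^sub>2 Y f h e =
     glue_case (j\<^sub>1 (ext k V\<^sub>1) (ext k V\<^sub>2) Y (tensor_sum_map k V\<^sub>2 f h))
               (j\<^sub>2 (ext k V\<^sub>1) (ext k V\<^sub>2) Y (tensor_sum_map k V\<^sub>2 f h))
       (Phi_sum k V\<^sub>1 V\<^sub>2 Y f h (dsum_map k (\<lambda>n. Phi_tensor n V\<^sub>1 V\<^sub>2 Y f h) e))"


section \<open>Clifford actions\<close>

text \<open>\<open>c\<close> is a unital algebra homomorphism from the Clifford algebra of the fibre at \<open>x\<close> to the
  endomorphisms of its exterior algebra, with the prescribed values on vectors.  The index \<open>i\<close> starts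
  at \<open>0\<close>, so that \<open>(-1)\<^sup>i\<close> is \<open>(-1)\<^sup>j\<^sup>+\<^sup>1\<close> for \<open>j = i + 1\<close>.\<close>

definition is_clifford_action ::
    "nat \<Rightarrow> ('v, 'x) pbundle \<Rightarrow> ('x \<Rightarrow> 'v \<Rightarrow> 'v \<Rightarrow> real) \<Rightarrow> 'x \<Rightarrow>
     ('x \<times> 'v words set \<Rightarrow> (nat \<Rightarrow> 'x \<times> 'v words set) \<Rightarrow> (nat \<Rightarrow> 'x \<times> 'v words set)) \<Rightarrow> bool" where
  "is_clifford_action k V g x c \<longleftrightarrow> (let C = clifford V g; L = ext k V in
     c \<in> fibre C x \<rightarrow>\<^sub>E (fibre L x \<rightarrow>\<^sub>E fibre L x) \<and>
     (\<forall>a\<in>fibre C x. \<forall>e\<in>fibre L x. \<forall>e'\<in>fibre L x. c a (vadd L e e') = vadd L (c a e) (c a e')) \<and>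
     (\<forall>a\<in>fibre C x. \<forall>e\<in>fibre L x. \<forall>r. c a (vscale L r e) = vscale L r (c a e)) \<and>
     (\<forall>a\<in>fibre C x. \<forall>b\<in>fibre C x. \<forall>e\<in>fibre L x. c (vadd C a b) e = vadd L (c a e) (c b e)) \<and>
     (\<forall>a\<in>fibre C x. \<forall>r. \<forall>e\<in>fibre L x. c (vscale C r a) e = vscale L r (c a e)) \<and>
     (\<forall>a\<in>fibre C x. \<forall>b\<in>fibre C x. \<forall>e\<in>fibre L x. c (clifford_mult V g a b) e = c a (c b e)) \<and>
     (\<forall>e\<in>fibre L x. c (clifford_word V g x []) e = e) \<and>
     (\<forall>v\<in>fibre V x. \<forall>vs\<in>lists (fibre V x). length vs \<le> k \<longrightarrow>
        c (clifford_word V g x [v]) (wedge k V x (word vs)) =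
        wedge k V x (word (v # vs) -
          (\<Sum>i<length vs. ((-1) ^ i * g x v (vs ! i)) *\<^sub>R word (take i vs @ drop (Suc i) vs)))))"

text \<open>These conditions determine \<open>c\<close> uniquely, as a function normalised to be \<^const>\<open>undefined\<close> off the
  fibres; the default value is never taken when \<open>k\<close> bounds the dimension of the fibre and \<open>g x\<close> is a
  symmetric bilinear form on it.\<close>

definition clifford_action ::
    "nat \<Rightarrow> ('v, 'x) pbundle \<Rightarrow> ('x \<Rightarrow> 'v \<Rightarrow> 'v \<Rightarrow> real) \<Rightarrow>
     'x \<times> 'v words set \<Rightarrow> (nat \<Rightarrow> 'x \<times> 'v words set) \<Rightarrow> (nat \<Rightarrow> 'x \<times> 'v words set)" where
  "clifford_action k V g a e = (let x = proj (clifford V g) a in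
     if \<exists>!c. is_clifford_action k V g x c then (THE c. is_clifford_action k V g x c) a e
     else vzero (ext k V) x)"

definition glued_clifford_action ::
    "nat \<Rightarrow> ('v, 'x) pbundle \<Rightarrow> ('w, 'y) pbundle \<Rightarrow> 'x set \<Rightarrow> ('x \<Rightarrow> 'y) \<Rightarrow> ('v \<Rightarrow> 'w) \<Rightarrow>
     ('x \<Rightarrow> 'v \<Rightarrow> 'v \<Rightarrow> real) \<Rightarrow> ('y \<Rightarrow> 'w \<Rightarrow> 'w \<Rightarrow> real) \<Rightarrow>
     ('x \<times> 'v words set + 'y \<times> 'w words set) set \<Rightarrow>
     ((nat \<Rightarrow> 'x \<times> 'v words set) + (nat \<Rightarrow> 'y \<times> 'w words set)) set \<Rightarrow>
     ((nat \<Rightarrow> 'x \<times> 'v words set) + (nat \<Rightarrow> 'y \<times> 'w words set)) set" where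
  "glued_clifford_action k V\<^sub>1 V\<^sub>2 Y f h g\<^sub>1 g\<^sub>2 a e =
     (let L\<^sub>1 = ext k V\<^sub>1; L\<^sub>2 = ext k V\<^sub>2; H = tensor_sum_map k V\<^sub>2 f h in
      glue_case
        (\<lambda>x. j\<^sub>1 L\<^sub>1 L\<^sub>2 Y H (clifford_action k V\<^sub>1 g\<^sub>1 (out1 a) (out1 e)))
        (\<lambda>x. j\<^sub>2 L\<^sub>1 L\<^sub>2 Y H (clifford_action k V\<^sub>2 g\<^sub>2 (out2 a) (out2 e)))
        (proj (glue_clifford V\<^sub>1 V\<^sub>2 Y f h g\<^sub>1 g\<^sub>2) a))"

end

theory Submission
  imports Defs
begin

text \<open>Over a point of \<open>i\<^sub>2(X\<^sub>2)\<close> the map \<open>j\<^sub>2\<close> is a linear isometry of the fibre of \<open>V\<^sub>2\<close> onto the fibre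
  of the glued pseudo-bundle, and over \<open>i\<^sub>1(X\<^sub>1 - Y)\<close> so is \<open>j\<^sub>1\<close>.  A linear isometry of fibres induces
  isomorphisms of the Clifford and exterior algebras which intertwine the Clifford actions, because
  the conditions characterising the action are invariant under transport of structure; in particular
  the action is uniquely determined on one side iff it is on the other, so that its existence need
  not be established.  On each fibre, \<open>\<Phi>\<^sub>\<Lambda>\<close> and the inverse of \<open>\<Phi>\<^sub>C\<^sub>l\<close> are the inverses of these induced
  isomorphisms followed by the natural inclusions into the gluings.\<close>

section \<open>Words and cosets\<close>

text \<open>The obstacle is the encoding: elements of the tensor and Clifford algebras are cosets in
  a free vector space on words, and every operation is a union over representatives. Each statement
  is therefore moved to words, where an isometry acts letter by letter and commutes with
  concatenation, antisymmetrisation and extraction of a degree; it comes back to cosets because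
  relations go to relations. Compatibility of the metrics is what makes \<open>h\<close> respect the
  Clifford relations over \<open>Y\<close>, so that \<open>F_Cl\<close> takes values in the second
  Clifford bundle and the glued Clifford bundle splits into the same two cases as the glued base.
  The inverse of \<open>Phi_Cl\<close> is an \<open>inv_into\<close> over the whole total space,
  which calls for global injectivity and not only for injectivity on fibres. Finally, an action that
  is not uniquely determined has the zero vector as its value, so the argument also has to transport
  this default.\<close>

lemma lin_ext_superset:
  assumes "finite A" "Poly_Mapping.keys t \<subseteq> A"
  shows "lin_ext \<phi> t = (\<Sum>a\<in>A. Poly_Mapping.lookup t a *\<^sub>R \<phi> a)"
  unfolding lin_ext_def
  by (rule sum.mono_neutral_left) (use assms in \<open>auto simp: in_keys_iff\<close>)

lemma linear_lin_ext: "linear (lin_ext \<phi>)"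
proof (rule linearI)
  fix s t :: "'a \<Rightarrow>\<^sub>0 real" and r :: real
  let ?A = "Poly_Mapping.keys s \<union> Poly_Mapping.keys t"
  have "lin_ext \<phi> (s + t) = (\<Sum>a\<in>?A. Poly_Mapping.lookup (s + t) a *\<^sub>R \<phi> a)"
    by (rule lin_ext_superset) (use keys_add[of s t] in auto)
  also have "\<dots> = lin_ext \<phi> s + lin_ext \<phi> t"
    by (simp add: lin_ext_superset[of ?A] lookup_add scaleR_left_distrib sum.distrib)
  finally show "lin_ext \<phi> (s + t) = lin_ext \<phi> s + lin_ext \<phi> t" .
  have "Poly_Mapping.keys (r *\<^sub>R s) \<subseteq> Poly_Mapping.keys s"
    by (auto simp: in_keys_iff)
  then show "lin_ext \<phi> (r *\<^sub>R s) = r *\<^sub>R lin_ext \<phi> s"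
    by (simp add: lin_ext_superset[of "Poly_Mapping.keys s"] scaleR_sum_right)
qed

lemmas lin_ext_linear_simps =
  linear_add[OF linear_lin_ext] linear_diff[OF linear_lin_ext] linear_cmul[OF linear_lin_ext]
  linear_sum[OF linear_lin_ext] linear_0[OF linear_lin_ext]

lemma lin_ext_word [simp]: "lin_ext \<phi> (word ws) = \<phi> ws"
  by (simp add: lin_ext_def word_def)

text \<open>Words form a basis; with \<open>linear_lin_ext_comp\<close> this reduces an identity
  between linear maps to single words.\<close>

lemma lin_ext_word_id [simp]: "lin_ext word t = t"
proof (rule poly_mapping_eqI)
  fix ws
  have lookup_sum: "Poly_Mapping.lookup (\<Sum>us\<in>A. c us *\<^sub>R word us) ws =
      (\<Sum>us\<in>A. c us * Poly_Mapping.lookup (word us) ws)" for A and c :: "'a list \<Rightarrow> real"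
    by (induction A rule: infinite_finite_induct) (auto simp: lookup_add)
  show "Poly_Mapping.lookup (lin_ext word t) ws = Poly_Mapping.lookup t ws"
    by (simp only: lin_ext_def lookup_sum)
      (simp add: word_def lookup_single when_def if_distrib[of "(*) _"] in_keys_iff cong: if_cong)
qed

lemma linear_lin_ext_comp: "linear f \<Longrightarrow> f (lin_ext \<phi> t) = lin_ext (\<lambda>ws. f (\<phi> ws)) t"
  by (simp add: lin_ext_def linear_sum linear_cmul)

lemma lin_ext_cong:
  "(\<And>ws. ws \<in> Poly_Mapping.keys t \<Longrightarrow> \<phi> ws = \<psi> ws) \<Longrightarrow> lin_ext \<phi> t = lin_ext \<psi> t"
  by (simp add: lin_ext_def)

lemma lin_ext_mem:
  assumes "subspace S" "\<And>ws. ws \<in> Poly_Mapping.keys t \<Longrightarrow> \<phi> ws \<in> S"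
  shows "lin_ext \<phi> t \<in> S"
  unfolding lin_ext_def using assms by (intro subspace_sum) (auto intro: subspace_scale)

text \<open>The support condition is packaged as a subspace, the form in which
  \<open>lin_ext_mem\<close> and \<open>span_minimal\<close> can use it.\<close>

definition words_on :: "'v list set \<Rightarrow> 'v words set" where
  "words_on A = {t. Poly_Mapping.keys t \<subseteq> A}"

lemma subspace_words_on: "subspace (words_on A)"
  unfolding subspace_def words_on_def
proof (intro conjI ballI allI, simp_all)
  fix s t :: "'a words"
  assume "Poly_Mapping.keys s \<subseteq> A" "Poly_Mapping.keys t \<subseteq> A"
  then show "Poly_Mapping.keys (s + t) \<subseteq> A"
    using keys_add[of s t] by blast
next
  fix r and t :: "'a words"
  assume "Poly_Mapping.keys t \<subseteq> A"
  then show "Poly_Mapping.keys (r *\<^sub>R t) \<subseteq> A"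
    by (auto simp: in_keys_iff)
qed

lemma word_in_words_on [simp]: "word ws \<in> words_on A \<longleftrightarrow> ws \<in> A"
  by (simp add: words_on_def word_def)

lemmas words_on_intros =
  subspace_add[OF subspace_words_on] subspace_diff[OF subspace_words_on]
  subspace_scale[OF subspace_words_on] subspace_0[OF subspace_words_on]
  subspace_sum[OF subspace_words_on]

lemma lin_ext_words_on:
  "t \<in> words_on A \<Longrightarrow> (\<And>ws. ws \<in> A \<Longrightarrow> \<phi> ws \<in> words_on C) \<Longrightarrow> lin_ext \<phi> t \<in> words_on C"
  by (rule lin_ext_mem[OF subspace_words_on]) (auto simp: words_on_def)

text \<open>The homomorphism of free algebras extending \<open>j\<close>: the linear map inside
  \<open>word_map\<close>, before passage to cosets.\<close>

definition word_hom :: "('v \<Rightarrow> 'w) \<Rightarrow> 'v words \<Rightarrow> 'w words" where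
  "word_hom j = lin_ext (\<lambda>ws. word (map j ws))"

lemma linear_word_hom: "linear (word_hom j)"
  unfolding word_hom_def by (rule linear_lin_ext)

lemma word_hom_word [simp]: "word_hom j (word ws) = word (map j ws)"
  by (simp add: word_hom_def)

lemmas word_hom_simps [simp] =
  linear_add[OF linear_word_hom] linear_diff[OF linear_word_hom] linear_cmul[OF linear_word_hom]
  linear_sum[OF linear_word_hom] linear_0[OF linear_word_hom]

text \<open>Both maps act letter by letter, so an inverse on letters suffices; the support condition
  confines the letters to \<open>F\<close>, where \<open>j'\<close> is known to invert
  \<open>j\<close>.\<close>

lemma word_hom_inverse:
  assumes "t \<in> words_on (lists F)" "\<And>v. v \<in> F \<Longrightarrow> j' (j v) = v"
  shows "word_hom j' (word_hom j t) = t"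
proof -
  have "word_hom j' (word_hom j t) = lin_ext (\<lambda>ws. word (map j' (map j ws))) t"
    unfolding word_hom_def[of j] by (simp add: linear_lin_ext_comp[OF linear_word_hom])
  also have "\<dots> = lin_ext word t"
  proof (rule lin_ext_cong)
    fix ws assume "ws \<in> Poly_Mapping.keys t"
    then have "\<forall>v\<in>set ws. v \<in> F" using assms(1) by (auto simp: words_on_def)
    then have "map j' (map j ws) = ws" by (induction ws) (auto simp: assms(2))
    then show "word (map j' (map j ws)) = word ws" by simp
  qed
  finally show ?thesis by simp
qed

text \<open>The product of the free algebra, as it occurs inside
  \<open>clifford_mult\<close>.\<close>

definition conc :: "'v words \<Rightarrow> 'v words \<Rightarrow> 'v words" where
  "conc s t = lin_ext (\<lambda>us. lin_ext (\<lambda>vs. word (us @ vs)) t) s"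

lemma conc_word [simp]: "conc (word us) (word vs) = word (us @ vs)"
  by (simp add: conc_def)

lemma linear_conc_left: "linear (\<lambda>s. conc s t)"
  unfolding conc_def by (rule linear_lin_ext)

lemma linear_conc_right: "linear (conc s)"
  by (rule linearI)
    (simp_all add: conc_def lin_ext_def[of _ s] lin_ext_linear_simps sum.distrib scaleR_right_distrib
      scaleR_sum_right mult.commute)

lemmas conc_simps =
  linear_add[OF linear_conc_left] linear_diff[OF linear_conc_left] linear_cmul[OF linear_conc_left]
  linear_add[OF linear_conc_right] linear_diff[OF linear_conc_right] linear_cmul[OF linear_conc_right]

lemma conc_words_on_lists:
  "s \<in> words_on (lists F) \<Longrightarrow> t \<in> words_on (lists F) \<Longrightarrow> conc s t \<in> words_on (lists F)"
  unfolding conc_def by (intro lin_ext_words_on) auto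

lemma word_hom_conc: "word_hom j (conc s t) = conc (word_hom j s) (word_hom j t)"
  unfolding conc_def word_hom_def
  by (simp add: linear_lin_ext_comp[OF linear_lin_ext])

lemma alt_word:
  "alt (word ws) = (1 / fact (length ws)) *\<^sub>R
     (\<Sum>\<sigma> | \<sigma> permutes {..<length ws}. of_int (sign \<sigma>) *\<^sub>R word (permute_list \<sigma> ws))"
  by (simp add: alt_def)

lemma linear_alt: "linear alt"
  unfolding alt_def by (rule linear_lin_ext)

text \<open>On a word, permuting positions commutes with changing letters; linearity of both sides
  does the rest.\<close>

lemma word_hom_alt: "word_hom j (alt t) = alt (word_hom j t)"
proof -
  have "word_hom j (alt (word ws)) = alt (word (map j ws))" for ws
    by (auto simp: alt_word permute_list_map intro!: sum.cong)
  moreover have "alt t = lin_ext (\<lambda>ws. alt (word ws)) t"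
    by (simp add: linear_lin_ext_comp[OF linear_alt, of word, symmetric])
  moreover have "alt (word_hom j t) = lin_ext (\<lambda>ws. alt (word (map j ws))) t"
    by (simp add: word_hom_def linear_lin_ext_comp[OF linear_alt])
  ultimately show ?thesis
    by (simp add: linear_lin_ext_comp[OF linear_word_hom])
qed

text \<open>The projection that \<open>wedge\<close> applies before \<open>Alt\<close>.\<close>

definition degree_part :: "nat \<Rightarrow> 'v words \<Rightarrow> 'v words" where
  "degree_part n = lin_ext (\<lambda>ws. if length ws = n then word ws else 0)"

lemma word_hom_degree_part: "word_hom j (degree_part n t) = degree_part n (word_hom j t)"
  by (auto simp: degree_part_def word_hom_def linear_lin_ext_comp[OF linear_lin_ext]
      lin_ext_linear_simps intro!: lin_ext_cong)

lemma degree_part_words_on: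
  "t \<in> words_on A \<Longrightarrow> degree_part n t \<in> words_on {ws \<in> A. length ws = n}"
  unfolding degree_part_def by (rule lin_ext_words_on) (auto intro: words_on_intros)

abbreviation homog :: "'v set \<Rightarrow> nat \<Rightarrow> 'v list set" where
  "homog F n \<equiv> {ws \<in> lists F. length ws = n}"

lemma homog_subset: "t \<in> words_on (homog F n) \<Longrightarrow> t \<in> words_on (lists F)"
  by (auto simp: words_on_def)

lemma alt_words_on: 
  assumes "t \<in> words_on (homog F n)"
  shows "alt t \<in> words_on (homog F n)"
  unfolding alt_def
proof (rule lin_ext_words_on[OF assms])
  fix ws assume ws: "ws \<in> homog F n"
  have "permute_list \<sigma> ws \<in> homog F n" if "\<sigma> permutes {..<length ws}" for \<sigma>
    using ws that by (auto simp: in_lists_conv_set)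
  then show "(1 / fact (length ws)) *\<^sub>R
     (\<Sum>\<sigma> | \<sigma> permutes {..<length ws}. of_int (sign \<sigma>) *\<^sub>R word (permute_list \<sigma> ws)) \<in> words_on (homog F n)"
    by (intro words_on_intros) auto
qed

section \<open>Cosets and descent of linear maps to quotients\<close>

lemma coset_eq_iff: "coset R s = coset R t \<longleftrightarrow> s - t \<in> span R"
proof
  assume "coset R s = coset R t"
  moreover have "s \<in> coset R s" by (simp add: coset_def span_zero)
  ultimately show "s - t \<in> span R" by (auto simp: coset_def)
next
  assume st: "s - t \<in> span R"
  have "u - s \<in> span R \<longleftrightarrow> u - t \<in> span R" for u
    using span_add[OF _ st, of "u - s"] span_diff[OF _ st, of "u - t"] by auto
  then show "coset R s = coset R t" by (auto simp: coset_def)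
qed

lemma coset_self: "t \<in> coset R t"
  by (simp add: coset_def span_zero)

text \<open>The pattern behind all operations on cosets: when the result is independent of the
  representative, the union collapses to one coset, and \<open>coset_self\<close> ensures that it is
  not empty.\<close>

lemma UN_coset_eq:
  assumes "\<And>s. s \<in> coset R t \<Longrightarrow> coset R' (\<phi> s) = coset R' (\<phi> t)"
  shows "(\<Union>s\<in>coset R t. coset R' (\<phi> s)) = coset R' (\<phi> t)"
  using assms coset_self[of t R] by blast

lemma linear_span_mem:
  assumes "linear \<phi>" "\<And>r. r \<in> R \<Longrightarrow> \<phi> r \<in> span R'" "r \<in> span R"
  shows "\<phi> r \<in> span R'"
  using assms linear_span_image[OF assms(1), of R] span_minimal[OF _ subspace_span, of "\<phi> ` R" R']
  by blast

text \<open>Two representatives differ by an element of \<open>span R\<close>, and by linearity it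
  is enough to control the generators.\<close>

lemma UN_linear_coset_eq:
  assumes "linear \<phi>" "\<And>r. r \<in> R \<Longrightarrow> \<phi> r \<in> span R'"
  shows "(\<Union>s\<in>coset R t. coset R' (\<phi> s)) = coset R' (\<phi> t)"
proof (rule UN_coset_eq)
  fix s assume s: "s \<in> coset R t"
  then show "coset R' (\<phi> s) = coset R' (\<phi> t)"
    using linear_span_mem[of \<phi> R R' "s - t"] assms
    by (simp add: coset_eq_iff linear_diff[OF assms(1), symmetric]) (simp add: coset_def)
qed

lemma word_map_coset:
  assumes "\<And>r. r \<in> R x \<Longrightarrow> word_hom j r \<in> span (R' (i x))"
  shows "word_map R' i j (x, coset (R x) t) = (i x, coset (R' (i x)) (word_hom j t))"
  using UN_linear_coset_eq[OF linear_word_hom, of "R x" j "R' (i x)"] assms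
  by (simp add: word_map_def word_hom_def[symmetric])

lemma fst_word_map: "fst (word_map R i j a) = i (fst a)"
  by (simp add: word_map_def split: prod.split)

text \<open>The two unions collapse one after the other; the base point \<open>y\<close> of the
  second summand is discarded by the definition.\<close>

lemma vadd_quot_bundle:
  "vadd (quot_bundle X R D) (x, coset (R x) s) (y, coset (R x) t) = (x, coset (R x) (s + t))"
proof -
  have "(\<Union>t'\<in>coset (R x) t. coset (R x) (s' + t')) = coset (R x) (s' + t)" for s'
    by (rule UN_coset_eq) (simp add: coset_eq_iff, simp add: coset_def)
  moreover have "(\<Union>s'\<in>coset (R x) s. coset (R x) (s' + t)) = coset (R x) (s + t)"
    by (rule UN_coset_eq) (simp add: coset_eq_iff, simp add: coset_def)
  ultimately show ?thesis by (simp add: quot_bundle_def)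
qed

lemma vscale_quot_bundle:
  "vscale (quot_bundle X R D) a (x, coset (R x) t) = (x, coset (R x) (a *\<^sub>R t))"
  by (simp add: quot_bundle_def UN_linear_coset_eq[OF linear_scale_self] span_scale span_base)

text \<open>The marked slot moves to the position \<open>p\<close> with
  \<open>\<sigma> p = length us\<close>, and the other entries do not depend on \<open>z\<close>.
  One pair of contexts thus serves all \<open>z\<close>, which is what linearity in that slot
  requires.\<close>

lemma permute_list_append3:
  assumes "\<sigma> permutes {..<length us + Suc (length vs)}"
  obtains us' vs' where "set us' \<union> set vs' \<subseteq> set us \<union> set vs"
    and "\<And>z. permute_list \<sigma> (us @ [z] @ vs) = us' @ [z] @ vs'"
proof -
  let ?n = "length us + Suc (length vs)"
  obtain p where p: "p < ?n" "\<sigma> p = length us"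
    using permutes_image[OF assms] by (metis (no_types, lifting) imageE lessThan_iff less_add_Suc1 add_Suc_right)
  \<comment> \<open>Removing the slot shifts the later indices by one, so the remaining entries can
    be read from \<open>us @ vs\<close>.\<close>
  define entry where "entry k = (us @ vs) ! (if \<sigma> k < length us then \<sigma> k else \<sigma> k - 1)" for k
  have ne: "\<sigma> k \<noteq> length us" if "k \<noteq> p" for k
    using p(2) that permutes_inj[OF assms] by (metis injD)
  have lt: "\<sigma> k < ?n" if "k < ?n" for k
    using permutes_in_image[OF assms, of k] that by simp
  have entry: "(us @ [z] @ vs) ! \<sigma> k = entry k" if "k \<noteq> p" for k z
    using ne[OF that] by (auto simp: entry_def nth_append nth_Cons' Suc_diff_le)
  have entry_mem: "entry k \<in> set us \<union> set vs" if "k \<noteq> p" "k < ?n" for k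
  proof -
    have "(if \<sigma> k < length us then \<sigma> k else \<sigma> k - 1) < length (us @ vs)"
      using ne[OF that(1)] lt[OF that(2)] by auto
    then have "entry k \<in> set (us @ vs)"
      unfolding entry_def by (rule nth_mem)
    then show ?thesis by simp
  qed
  have upt: "[0..<?n] = [0..<p] @ [p] @ [Suc p..<?n]"
    using p(1) by (metis append_Cons append_Nil le0 less_imp_le upt_add_eq_append upt_conv_Cons
        le_add_diff_inverse)
  show ?thesis
  proof
    have "set (map entry [0..<p]) \<union> set (map entry [Suc p..<?n]) \<subseteq> entry ` {k. k \<noteq> p \<and> k < ?n}"
      using p(1) by (auto simp del: upt_Suc)
    also have "\<dots> \<subseteq> set us \<union> set vs"
      using entry_mem by blast
    finally show "set (map entry [0..<p]) \<union> set (map entry [Suc p..<?n]) \<subseteq> set us \<union> set vs" .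
    show "permute_list \<sigma> (us @ [z] @ vs) = map entry [0..<p] @ [z] @ map entry [Suc p..<?n]" for z
    proof -
      have "permute_list \<sigma> (us @ [z] @ vs) = map (\<lambda>k. (us @ [z] @ vs) ! \<sigma> k) [0..<?n]"
        by (simp add: permute_list_def del: upt_Suc)
      also have "\<dots> = map (\<lambda>k. (us @ [z] @ vs) ! \<sigma> k) [0..<p] @ [(us @ [z] @ vs) ! \<sigma> p] @
          map (\<lambda>k. (us @ [z] @ vs) ! \<sigma> k) [Suc p..<?n]"
        unfolding upt by simp
      also have "\<dots> = map entry [0..<p] @ [z] @ map entry [Suc p..<?n]"
        using entry by (simp add: p(2) del: upt_Suc append_assoc)
      finally show ?thesis .
    qed
  qed
qed


section \<open>Clifford and exterior algebra of a fibre\<close>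

text \<open>In \<open>dsum\<close> the components are compared with component \<open>0\<close>; over
  a fixed point this becomes an independent condition on each component, so the fibre is a full
  product.\<close>

lemma fibre_dsum: "fibre (dsum k C) x = (\<Pi>\<^sub>E n\<in>{..k}. fibre (C n) x)"
proof (intro equalityI subsetI)
  fix s assume "s \<in> fibre (dsum k C) x"
  then have s: "s \<in> (\<Pi>\<^sub>E n\<in>{..k}. pts (tot (C n)))" "\<forall>n\<le>k. proj (C n) (s n) = proj (C 0) (s 0)"
      "proj (C 0) (s 0) = x"
    by (simp_all add: dsum_def fibre_def over_def Let_def)
  then have "proj (C n) (s n) = x" if "n \<le> k" for n
    using that by metis
  then show "s \<in> (\<Pi>\<^sub>E n\<in>{..k}. fibre (C n) x)"
    using s(1) by (simp add: PiE_iff fibre_def over_def)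
next
  fix s assume "s \<in> (\<Pi>\<^sub>E n\<in>{..k}. fibre (C n) x)"
  then have "s \<in> (\<Pi>\<^sub>E n\<in>{..k}. pts (tot (C n)))" and "\<And>n. n \<le> k \<Longrightarrow> proj (C n) (s n) = x"
    by (auto simp: PiE_iff fibre_def over_def)
  then show "s \<in> fibre (dsum k C) x"
    by (simp add: dsum_def fibre_def over_def Let_def)
qed

lemma vadd_dsum: "vadd (dsum k C) s s' = (\<lambda>n\<in>{..k}. vadd (C n) (s n) (s' n))"
  and vscale_dsum: "vscale (dsum k C) a s = (\<lambda>n\<in>{..k}. vscale (C n) a (s n))"
  and vzero_dsum: "vzero (dsum k C) x = (\<lambda>n\<in>{..k}. vzero (C n) x)"
  and proj_dsum: "proj (dsum k C) s = proj (C 0) (s 0)"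
  by (simp_all add: dsum_def Let_def)

lemma base_tpow [simp]: "base (tpow n V) = base V"
  and proj_tpow [simp]: "proj (tpow n V) = fst"
  and base_clifford [simp]: "base (clifford V g) = base V"
  and proj_clifford [simp]: "proj (clifford V g) = fst"
  by (simp_all add: tpow_def quot_bundle_def clifford_def)

text \<open>The relations mention addition and scaling of letters; closure of the fibre under both
  keeps every relation supported on words over the fibre.\<close>

locale bundle_fibre =
  fixes B :: "('v, 'x) pbundle" and x :: 'x
  assumes base: "x \<in> pts (base B)"
    and vadd_closed: "\<And>v w. v \<in> fibre B x \<Longrightarrow> w \<in> fibre B x \<Longrightarrow> vadd B v w \<in> fibre B x"
    and vscale_closed: "\<And>a v. v \<in> fibre B x \<Longrightarrow> vscale B a v \<in> fibre B x"
begin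

lemma multilin_cases [consumes 1, case_names add scale]:
  assumes "r \<in> multilin B x"
  obtains us vs v w where "us \<in> lists (fibre B x)" "vs \<in> lists (fibre B x)"
      "v \<in> fibre B x" "w \<in> fibre B x"
      "r = word (us @ [vadd B v w] @ vs) - word (us @ [v] @ vs) - word (us @ [w] @ vs)"
    | us vs v a where "us \<in> lists (fibre B x)" "vs \<in> lists (fibre B x)" "v \<in> fibre B x"
      "r = word (us @ [vscale B a v] @ vs) - a *\<^sub>R word (us @ [v] @ vs)"
  using assms unfolding multilin_def by blast

lemma multilin_add:
  "us \<in> lists (fibre B x) \<Longrightarrow> vs \<in> lists (fibre B x) \<Longrightarrow> v \<in> fibre B x \<Longrightarrow> w \<in> fibre B x \<Longrightarrow>
   word (us @ vadd B v w # vs) - word (us @ v # vs) - word (us @ w # vs) \<in> multilin B x"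
  unfolding multilin_def by (intro UnI1 CollectI exI[of _ us] exI[of _ vs] exI[of _ v] exI[of _ w]) simp

lemma multilin_scale:
  "us \<in> lists (fibre B x) \<Longrightarrow> vs \<in> lists (fibre B x) \<Longrightarrow> v \<in> fibre B x \<Longrightarrow>
   word (us @ vscale B a v # vs) - a *\<^sub>R word (us @ v # vs) \<in> multilin B x"
  unfolding multilin_def by (intro UnI2 CollectI exI[of _ us] exI[of _ vs] exI[of _ v] exI[of _ a]) simp

lemma clifford_rel_cases [consumes 1, case_names multilin clifford]:
  assumes "r \<in> clifford_rel B g x"
  obtains "r \<in> multilin B x"
    | us vs v w where "us \<in> lists (fibre B x)" "vs \<in> lists (fibre B x)"
      "v \<in> fibre B x" "w \<in> fibre B x"
      "r = word (us @ [v, w] @ vs) + word (us @ [w, v] @ vs) + (2 * g x v w) *\<^sub>R word (us @ vs)"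
  using assms unfolding clifford_rel_def by blast

lemma clifford_rel_intro:
  "us \<in> lists (fibre B x) \<Longrightarrow> vs \<in> lists (fibre B x) \<Longrightarrow> v \<in> fibre B x \<Longrightarrow> w \<in> fibre B x \<Longrightarrow>
   word (us @ v # w # vs) + word (us @ w # v # vs) + (2 * g x v w) *\<^sub>R word (us @ vs)
     \<in> clifford_rel B g x"
  unfolding clifford_rel_def
  by (intro UnI2 CollectI exI[of _ us] exI[of _ vs] exI[of _ v] exI[of _ w]) simp

lemma clifford_rel_words_on: "clifford_rel B g x \<subseteq> words_on (lists (fibre B x))"
proof
  fix r assume "r \<in> clifford_rel B g x"
  then show "r \<in> words_on (lists (fibre B x))"
  proof (cases rule: clifford_rel_cases)
    case multilin
    then show ?thesis
      by (cases rule: multilin_cases) (auto intro!: words_on_intros simp: vadd_closed vscale_closed)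
  qed (auto intro!: words_on_intros)
qed

text \<open>Relations come with arbitrary words on either side, so multiplying by a word merely
  lengthens these contexts.\<close>

lemma conc_word_clifford_rel:
  assumes r: "r \<in> clifford_rel B g x" and ps: "ps \<in> lists (fibre B x)"
  shows "conc (word ps) r \<in> clifford_rel B g x" "conc r (word ps) \<in> clifford_rel B g x"
proof -
  have sub: "multilin B x \<subseteq> clifford_rel B g x"
    by (simp add: clifford_rel_def)
  from r have "conc (word ps) r \<in> clifford_rel B g x \<and> conc r (word ps) \<in> clifford_rel B g x"
  proof (cases rule: clifford_rel_cases)
    case multilin
    then show ?thesis
    proof (cases rule: multilin_cases)
      case (add us vs v w)
      then show ?thesis
        using multilin_add[of "ps @ us" vs v w] multilin_add[of us "vs @ ps" v w] ps sub
        by (auto simp: conc_simps)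
    next
      case (scale us vs v a)
      then show ?thesis
        using multilin_scale[of "ps @ us" vs v a] multilin_scale[of us "vs @ ps" v a] ps sub
        by (auto simp: conc_simps)
    qed
  next
    case (clifford us vs v w)
    then show ?thesis
      using clifford_rel_intro[of "ps @ us" vs v w g] clifford_rel_intro[of us "vs @ ps" v w g] ps
      by (auto simp: conc_simps)
  qed
  then show "conc (word ps) r \<in> clifford_rel B g x" "conc r (word ps) \<in> clifford_rel B g x"
    by auto
qed

text \<open>Expansion of \<open>t\<close> into words reduces this to
  \<open>conc_word_clifford_rel\<close>; the words must lie over the fibre because relations admit
  only such contexts.\<close>

lemma conc_clifford_ideal:
  assumes r: "r \<in> span (clifford_rel B g x)" and t: "t \<in> words_on (lists (fibre B x))"
  shows "conc t r \<in> span (clifford_rel B g x)" "conc r t \<in> span (clifford_rel B g x)"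
proof -
  let ?I = "span (clifford_rel B g x)"
  have word: "conc (word ps) r \<in> ?I" "conc r (word ps) \<in> ?I" if "ps \<in> lists (fibre B x)" for ps
    using linear_span_mem[OF linear_conc_right _ r] linear_span_mem[OF linear_conc_left _ r]
      conc_word_clifford_rel[OF _ that] span_base by metis+
  have t_lists: "ps \<in> lists (fibre B x)" if "ps \<in> Poly_Mapping.keys t" for ps
    using t that by (auto simp: words_on_def)
  have "conc t r = lin_ext (\<lambda>ps. conc (word ps) r) t"
    using linear_lin_ext_comp[OF linear_conc_left, of word t] by simp
  moreover have "conc r t = lin_ext (\<lambda>ps. conc r (word ps)) t"
    using linear_lin_ext_comp[OF linear_conc_right, of r word t] by simp
  ultimately show "conc t r \<in> ?I" "conc r t \<in> ?I"
    using word t_lists by (auto intro!: lin_ext_mem)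
qed

lemma clifford_mult_coset:
  assumes "s \<in> words_on (lists (fibre B x))" "t \<in> words_on (lists (fibre B x))"
  shows "clifford_mult B g (x, coset (clifford_rel B g x) s) (x, coset (clifford_rel B g x) t) =
    (x, coset (clifford_rel B g x) (conc s t))"
proof -
  let ?R = "clifford_rel B g x"
  have "(\<Union>t'\<in>coset ?R t. coset ?R (conc s' t')) = coset ?R (conc s' t)" if "s' \<in> coset ?R s" for s'
  proof (rule UN_coset_eq)
    fix t' assume t': "t' \<in> coset ?R t"
    \<comment> \<open>The relations are supported on words over the fibre, hence so is every
      representative of a coset that has one such representative. This makes the ideal property
      applicable with left factor \<open>s'\<close>.\<close>
    have "s' - s \<in> words_on (lists (fibre B x))"
      using that span_minimal[OF clifford_rel_words_on subspace_words_on] by (auto simp: coset_def)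
    then have "s' \<in> words_on (lists (fibre B x))"
      using words_on_intros(1)[OF _ assms(1)] by fastforce
    then show "coset ?R (conc s' t') = coset ?R (conc s' t)"
      using conc_clifford_ideal(1)[of "t' - t"] t' by (simp add: coset_eq_iff conc_simps) (simp add: coset_def conc_simps)
  qed
  moreover have "(\<Union>s'\<in>coset ?R s. coset ?R (conc s' t)) = coset ?R (conc s t)"
    using conc_clifford_ideal(2)[OF span_base assms(2)]
    by (intro UN_linear_coset_eq linear_conc_left)
  ultimately show ?thesis
    by (simp add: clifford_mult_def conc_def[symmetric])
qed

text \<open>Each permutation carries a multilinearity relation to another one, with the slot moved,
  so antisymmetrisation descends to tensors.\<close>

lemma alt_multilin:
  assumes "r \<in> multilin B x"
  shows "alt r \<in> span (multilin B x)"
proof -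
  \<comment> \<open>One shape covers both kinds of relation: \<open>a = b = 1\<close> is additivity,
    and \<open>b = 0\<close> is homogeneity.\<close>
  have mem: "alt (word (us @ [z\<^sub>0] @ vs)) - a *\<^sub>R alt (word (us @ [z\<^sub>1] @ vs)) - b *\<^sub>R alt (word (us @ [z\<^sub>2] @ vs))
      \<in> span (multilin B x)"
    if lists: "us \<in> lists (fibre B x)" "vs \<in> lists (fibre B x)"
    and rel: "\<And>us vs. us \<in> lists (fibre B x) \<Longrightarrow> vs \<in> lists (fibre B x) \<Longrightarrow>
      word (us @ [z\<^sub>0] @ vs) - a *\<^sub>R word (us @ [z\<^sub>1] @ vs) - b *\<^sub>R word (us @ [z\<^sub>2] @ vs) \<in> multilin B x"
    for us vs z\<^sub>0 z\<^sub>1 z\<^sub>2 a b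
  proof -
    let ?n = "length us + Suc (length vs)"
    let ?P = "\<lambda>\<sigma> z. word (permute_list \<sigma> (us @ [z] @ vs))"
    have "?P \<sigma> z\<^sub>0 - a *\<^sub>R ?P \<sigma> z\<^sub>1 - b *\<^sub>R ?P \<sigma> z\<^sub>2 \<in> multilin B x"
      if \<sigma>: "\<sigma> permutes {..<?n}" for \<sigma>
    proof -
      obtain us' vs' where sub: "set us' \<union> set vs' \<subseteq> set us \<union> set vs"
        and eq: "\<And>z. permute_list \<sigma> (us @ [z] @ vs) = us' @ [z] @ vs'"
        using permute_list_append3[OF \<sigma>] by metis
      have "us' \<in> lists (fibre B x)" "vs' \<in> lists (fibre B x)"
        using sub lists by (auto simp: in_lists_conv_set)
      then show ?thesis
        unfolding eq by (rule rel)
    qed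
    then have "(1 / fact ?n) *\<^sub>R (\<Sum>\<sigma> | \<sigma> permutes {..<?n}. of_int (sign \<sigma>) *\<^sub>R
        (?P \<sigma> z\<^sub>0 - a *\<^sub>R ?P \<sigma> z\<^sub>1 - b *\<^sub>R ?P \<sigma> z\<^sub>2)) \<in> span (multilin B x)"
      by (intro span_scale span_sum span_base) auto
    then show ?thesis
      by (simp add: alt_word scaleR_diff_right sum_subtractf scaleR_sum_right mult.commute[of a]
          mult.commute[of b] del: fact_Suc)
  qed
  from assms show ?thesis
  proof (cases rule: multilin_cases)
    case (add us vs v w)
    then show ?thesis
      using mem[of us vs "vadd B v w" 1 v 1 w] multilin_add
      by (simp add: linear_diff[OF linear_alt])
  next
    case (scale us vs v a)
    then show ?thesis
      using mem[of us vs "vscale B a v" a v 0 v] multilin_scale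
      by (simp add: linear_diff[OF linear_alt] linear_cmul[OF linear_alt])
  qed
qed

lemma Alt_coset: "Alt B (x, coset (multilin B x) t) = (x, coset (multilin B x) (alt t))"
  by (simp add: Alt_def UN_linear_coset_eq[OF linear_alt alt_multilin])

lemma fibre_clifford:
  "fibre (clifford B g) x = (\<lambda>t. (x, coset (clifford_rel B g x) t)) ` words_on (lists (fibre B x))"
  unfolding fibre_def[of "clifford B g"] over_def proj_clifford
  using base by (auto simp: clifford_def quot_bundle_def clifford_sp_def words_on_def)

lemma fibre_tpow:
  "fibre (tpow n B) x = (\<lambda>t. (x, coset (multilin B x) t)) ` words_on (homog (fibre B x) n)"
  unfolding fibre_def[of "tpow n B"] over_def proj_tpow
  using base by (auto simp: tpow_def quot_bundle_def tpow_sp_def tpow_pts_def words_on_def)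

lemma fibre_ext_pow:
  "fibre (ext_pow n B) x = (\<lambda>t. (x, coset (multilin B x) (alt t))) ` words_on (homog (fibre B x) n)"
proof -
  have "fibre (ext_pow n B) x = fibre (tpow n B) x \<inter> Alt B ` fibre (tpow n B) x"
    by (auto simp: fibre_def over_def ext_pow_def subsp_def Alt_def)
  \<comment> \<open>Antisymmetrisation preserves length, so its image already lies in the tensor
    power with which \<open>subsp\<close> intersects it.\<close>
  also have "\<dots> = Alt B ` fibre (tpow n B) x"
    by (auto simp: fibre_tpow Alt_coset intro!: image_eqI[OF refl] alt_words_on)
  finally show ?thesis
    by (simp add: fibre_tpow image_image Alt_coset)
qed


lemma fibre_ext:
  "fibre (ext k B) x = (\<Pi>\<^sub>E n\<in>{..k}. fibre (ext_pow n B) x)"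
  by (simp add: ext_def fibre_dsum)

lemma fibre_ext_pow_subset: "fibre (ext_pow n B) x \<subseteq> fibre (tpow n B) x"
  using alt_words_on by (force simp: fibre_ext_pow fibre_tpow)

lemma fibre_dsum_tpow_ext: "fibre (ext k B) x \<subseteq> fibre (dsum k (\<lambda>n. tpow n B)) x"
  unfolding fibre_ext fibre_dsum by (rule PiE_mono) (rule fibre_ext_pow_subset)

lemma vadd_ext: "vadd (ext k B) e e' = (\<lambda>n\<in>{..k}. vadd (quot_bundle (base B) (multilin B) (tpow_sp n B)) (e n) (e' n))"
  by (simp add: ext_def vadd_dsum ext_pow_def tpow_def)

lemma vscale_ext: "vscale (ext k B) a e = (\<lambda>n\<in>{..k}. vscale (quot_bundle (base B) (multilin B) (tpow_sp n B)) a (e n))"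
  by (simp add: ext_def vscale_dsum ext_pow_def tpow_def)

lemma vzero_ext: "vzero (ext k B) y = (\<lambda>n\<in>{..k}. (y, coset (multilin B y) 0))"
  by (simp add: ext_def vzero_dsum ext_pow_def tpow_def quot_bundle_def)

text \<open>A normal form for exterior vectors: \<open>t\<close> holds representatives before
  antisymmetrisation, on which the bundle operations become operations on words.\<close>

definition ext_elem :: "nat \<Rightarrow> (nat \<Rightarrow> 'v words) \<Rightarrow> nat \<Rightarrow> 'x \<times> 'v words set" where
  "ext_elem k t = (\<lambda>n\<in>{..k}. (x, coset (multilin B x) (alt (t n))))"

lemma ext_elem_in: "(\<And>n. t n \<in> words_on (homog (fibre B x) n)) \<Longrightarrow> ext_elem k t \<in> fibre (ext k B) x"
  by (auto simp: ext_elem_def fibre_ext fibre_ext_pow)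

lemma fibre_ext_cases:
  assumes "e \<in> fibre (ext k B) x"
  obtains t where "e = ext_elem k t" "\<And>n. t n \<in> words_on (homog (fibre B x) n)"
proof -
  \<comment> \<open>In degrees above \<open>k\<close>, where \<open>e\<close> carries no
    information, \<open>0\<close> is chosen; this makes \<open>t n\<close> homogeneous for every
    \<open>n\<close>.\<close>
  have "\<exists>t. t \<in> words_on (homog (fibre B x) n) \<and> (n \<le> k \<longrightarrow> e n = (x, coset (multilin B x) (alt t)))" for n
    using assms words_on_intros(4) by (cases "n \<le> k") (auto simp: fibre_ext fibre_ext_pow PiE_iff)
  then obtain t where t: "\<And>n. t n \<in> words_on (homog (fibre B x) n)"
      "\<And>n. n \<le> k \<Longrightarrow> e n = (x, coset (multilin B x) (alt (t n)))"
    by metis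
  have "e = ext_elem k t"
    using assms t(2) by (intro extensionalityI[of _ "{..k}"]) (auto simp: fibre_ext ext_elem_def PiE_iff)
  with t(1) that show thesis by blast
qed

lemma vadd_ext_elem: "vadd (ext k B) (ext_elem k s) (ext_elem k t) = ext_elem k (\<lambda>n. s n + t n)"
  by (auto simp: vadd_ext ext_elem_def vadd_quot_bundle linear_add[OF linear_alt])

lemma vscale_ext_elem: "vscale (ext k B) a (ext_elem k t) = ext_elem k (\<lambda>n. a *\<^sub>R t n)"
  by (auto simp: vscale_ext ext_elem_def vscale_quot_bundle linear_cmul[OF linear_alt])

lemma wedge_eq_ext_elem: "wedge k B x t = ext_elem k (\<lambda>n. degree_part n t)"
  by (auto simp: wedge_def ext_elem_def Alt_coset degree_part_def)

lemma wedge_in: "t \<in> words_on (lists (fibre B x)) \<Longrightarrow> wedge k B x t \<in> fibre (ext k B) x"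
  unfolding wedge_eq_ext_elem by (intro ext_elem_in degree_part_words_on)

lemma vadd_ext_in: "e \<in> fibre (ext k B) x \<Longrightarrow> e' \<in> fibre (ext k B) x \<Longrightarrow> vadd (ext k B) e e' \<in> fibre (ext k B) x"
  by (elim fibre_ext_cases) (simp add: vadd_ext_elem ext_elem_in words_on_intros)

lemma vscale_ext_in: "e \<in> fibre (ext k B) x \<Longrightarrow> vscale (ext k B) a e \<in> fibre (ext k B) x"
  by (elim fibre_ext_cases) (simp add: vscale_ext_elem ext_elem_in words_on_intros)

definition clifford_elem :: "('x \<Rightarrow> 'v \<Rightarrow> 'v \<Rightarrow> real) \<Rightarrow> 'v words \<Rightarrow> 'x \<times> 'v words set" where
  "clifford_elem g t = (x, coset (clifford_rel B g x) t)"

lemma fibre_clifford_cases: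
  assumes "a \<in> fibre (clifford B g) x"
  obtains t where "a = clifford_elem g t" "t \<in> words_on (lists (fibre B x))"
  using assms by (auto simp: fibre_clifford clifford_elem_def)

lemma clifford_elem_in: "t \<in> words_on (lists (fibre B x)) \<Longrightarrow> clifford_elem g t \<in> fibre (clifford B g) x"
  by (auto simp: fibre_clifford clifford_elem_def)

lemma vadd_clifford_elem: "vadd (clifford B g) (clifford_elem g s) (clifford_elem g t) = clifford_elem g (s + t)"
  and vscale_clifford_elem: "vscale (clifford B g) r (clifford_elem g t) = clifford_elem g (r *\<^sub>R t)"
  and clifford_word_eq: "clifford_word B g x ws = clifford_elem g (word ws)"
  by (simp_all add: clifford_elem_def clifford_def vadd_quot_bundle vscale_quot_bundle clifford_word_def)

lemma clifford_mult_elem: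
  assumes "s \<in> words_on (lists (fibre B x))" "t \<in> words_on (lists (fibre B x))"
  shows "clifford_mult B g (clifford_elem g s) (clifford_elem g t) = clifford_elem g (conc s t)"
  using assms by (simp add: clifford_elem_def clifford_mult_coset)

lemma clifford_closed:
  assumes "a \<in> fibre (clifford B g) x" "b \<in> fibre (clifford B g) x"
  shows "vadd (clifford B g) a b \<in> fibre (clifford B g) x"
    and "vscale (clifford B g) r a \<in> fibre (clifford B g) x"
    and "clifford_mult B g a b \<in> fibre (clifford B g) x"
  using assms
  by (elim fibre_clifford_cases; simp add: vadd_clifford_elem vscale_clifford_elem clifford_mult_elem
      clifford_elem_in words_on_intros conc_words_on_lists)+

lemma clifford_word_in: "ws \<in> lists (fibre B x) \<Longrightarrow> clifford_word B g x ws \<in> fibre (clifford B g) x"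
  by (simp add: clifford_word_eq clifford_elem_in)

end


section \<open>Linear isometries of fibres\<close>

text \<open>Bijectivity is left to \<open>fibre_iso\<close>, so that the gluing map \<open>h\<close>
  over a point of \<open>Y\<close> is an instance as well as the natural inclusions.\<close>

locale fibre_hom =
  source: bundle_fibre B x + target: bundle_fibre B' "i x"
  for B :: "('v, 'x) pbundle" and B' :: "('w, 'y) pbundle" and i :: "'x \<Rightarrow> 'y" and x :: 'x +
  fixes j :: "'v \<Rightarrow> 'w" and g :: "'x \<Rightarrow> 'v \<Rightarrow> 'v \<Rightarrow> real" and g' :: "'y \<Rightarrow> 'w \<Rightarrow> 'w \<Rightarrow> real"
  assumes j_in: "\<And>v. v \<in> fibre B x \<Longrightarrow> j v \<in> fibre B' (i x)"
    and j_vadd: "\<And>v w. v \<in> fibre B x \<Longrightarrow> w \<in> fibre B x \<Longrightarrow> j (vadd B v w) = vadd B' (j v) (j w)"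
    and j_vscale: "\<And>a v. v \<in> fibre B x \<Longrightarrow> j (vscale B a v) = vscale B' a (j v)"
    and j_metric: "\<And>v w. v \<in> fibre B x \<Longrightarrow> w \<in> fibre B x \<Longrightarrow> g' (i x) (j v) (j w) = g x v w"
begin

lemma map_in_lists: "ws \<in> lists (fibre B x) \<Longrightarrow> map j ws \<in> lists (fibre B' (i x))"
  using j_in by auto

lemma word_hom_words_on:
  "t \<in> words_on (lists (fibre B x)) \<Longrightarrow> word_hom j t \<in> words_on (lists (fibre B' (i x)))"
  unfolding word_hom_def by (erule lin_ext_words_on) (simp add: map_in_lists del: in_lists_conv_set)

lemma word_hom_homog:
  "t \<in> words_on (homog (fibre B x) n) \<Longrightarrow> word_hom j t \<in> words_on (homog (fibre B' (i x)) n)"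
  unfolding word_hom_def by (erule lin_ext_words_on) (auto simp: j_in)

text \<open>Linearity of \<open>j\<close> turns a relation into one of the same kind with the
  contexts mapped.\<close>

lemma word_hom_multilin: 
  assumes "r \<in> multilin B x"
  shows "word_hom j r \<in> multilin B' (i x)"
  using assms
proof (cases rule: source.multilin_cases)
  case (add us vs v w)
  then show ?thesis
    using target.multilin_add[OF map_in_lists map_in_lists j_in j_in, of us vs v w]
    by (simp add: j_vadd)
next
  case (scale us vs v a)
  then show ?thesis
    using target.multilin_scale[OF map_in_lists map_in_lists j_in, of us vs v a]
    by (simp add: j_vscale)
qed

text \<open>The metric enters here: the scalar in the Clifford relation is the same on both sides by
  \<open>j_metric\<close>.\<close>

lemma word_hom_clifford_rel: 
  assumes "r \<in> clifford_rel B g x"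
  shows "word_hom j r \<in> clifford_rel B' g' (i x)"
  using assms
proof (cases rule: source.clifford_rel_cases)
  case multilin
  then show ?thesis
    by (simp add: clifford_rel_def word_hom_multilin)
next
  case (clifford us vs v w)
  then show ?thesis
    using target.clifford_rel_intro[OF map_in_lists map_in_lists j_in j_in, of us vs v w g']
    by (simp add: j_metric)
qed

lemma word_map_multilin:
  "word_map (multilin B') i j (x, coset (multilin B x) t) = (i x, coset (multilin B' (i x)) (word_hom j t))"
  by (simp add: word_map_coset word_hom_multilin span_base)

text \<open>This is \<open>F_Cl\<close> when \<open>j\<close> is the gluing map over
  \<open>Y\<close>, and a branch of \<open>Phi_Cl\<close> when \<open>j\<close> is a natural
  inclusion.\<close>

definition clifford_hom :: "'x \<times> 'v words set \<Rightarrow> 'y \<times> 'w words set" where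
  "clifford_hom = word_map (clifford_rel B' g') i j"

definition ext_hom :: "nat \<Rightarrow> (nat \<Rightarrow> 'x \<times> 'v words set) \<Rightarrow> nat \<Rightarrow> 'y \<times> 'w words set" where
  "ext_hom k = dsum_map k (\<lambda>n. word_map (multilin B') i j)"

lemma clifford_hom_elem: "clifford_hom (source.clifford_elem g t) = target.clifford_elem g' (word_hom j t)"
  unfolding clifford_hom_def source.clifford_elem_def target.clifford_elem_def
  by (simp add: word_map_coset[of "clifford_rel B g"] word_hom_clifford_rel span_base)

lemma clifford_hom_in: "a \<in> fibre (clifford B g) x \<Longrightarrow> clifford_hom a \<in> fibre (clifford B' g') (i x)"
  by (elim source.fibre_clifford_cases)
    (simp add: clifford_hom_elem target.clifford_elem_in word_hom_words_on)

lemma clifford_hom_simps: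
  assumes "a \<in> fibre (clifford B g) x" "b \<in> fibre (clifford B g) x"
  shows "clifford_hom (vadd (clifford B g) a b) = vadd (clifford B' g') (clifford_hom a) (clifford_hom b)"
    and "clifford_hom (vscale (clifford B g) r a) = vscale (clifford B' g') r (clifford_hom a)"
    and "clifford_hom (clifford_mult B g a b) = clifford_mult B' g' (clifford_hom a) (clifford_hom b)"
  using assms
  by (elim source.fibre_clifford_cases; simp add: source.vadd_clifford_elem source.vscale_clifford_elem
      source.clifford_mult_elem target.vadd_clifford_elem target.vscale_clifford_elem
      target.clifford_mult_elem clifford_hom_elem word_hom_conc word_hom_words_on)+

lemma clifford_hom_word: "clifford_hom (clifford_word B g x ws) = clifford_word B' g' (i x) (map j ws)"
  by (simp add: source.clifford_word_eq target.clifford_word_eq clifford_hom_elem)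

lemma ext_hom_elem: "ext_hom k (source.ext_elem k t) = target.ext_elem k (\<lambda>n. word_hom j (t n))"
  by (auto simp: ext_hom_def dsum_map_def source.ext_elem_def target.ext_elem_def word_map_multilin
      word_hom_alt)

lemma ext_hom_in: "e \<in> fibre (ext k B) x \<Longrightarrow> ext_hom k e \<in> fibre (ext k B') (i x)"
  by (elim source.fibre_ext_cases) (simp add: ext_hom_elem target.ext_elem_in word_hom_homog)

lemma ext_hom_vadd:
  assumes "e \<in> fibre (ext k B) x" "e' \<in> fibre (ext k B) x"
  shows "ext_hom k (vadd (ext k B) e e') = vadd (ext k B') (ext_hom k e) (ext_hom k e')"
  using assms
  by (elim source.fibre_ext_cases) (simp add: ext_hom_elem source.vadd_ext_elem target.vadd_ext_elem)

lemma ext_hom_vscale: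
  assumes "e \<in> fibre (ext k B) x"
  shows "ext_hom k (vscale (ext k B) r e) = vscale (ext k B') r (ext_hom k e)"
  using assms
  by (elim source.fibre_ext_cases) (simp add: ext_hom_elem source.vscale_ext_elem target.vscale_ext_elem)

text \<open>Transports the default value of \<open>clifford_action\<close>.\<close>

lemma ext_hom_vzero: "ext_hom k (vzero (ext k B) x) = vzero (ext k B') (i x)"
  by (auto simp: ext_hom_def dsum_map_def source.vzero_ext target.vzero_ext word_map_multilin)

lemma ext_hom_wedge: "ext_hom k (wedge k B x t) = wedge k B' (i x) (word_hom j t)"
  by (simp add: source.wedge_eq_ext_elem target.wedge_eq_ext_elem ext_hom_elem word_hom_degree_part)

end

locale fibre_iso = fibre_hom B B' i x j g g'
  for B :: "('v, 'x) pbundle" and B' :: "('w, 'y) pbundle" and i :: "'x \<Rightarrow> 'y" and x :: 'x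
    and j :: "'v \<Rightarrow> 'w" and g :: "'x \<Rightarrow> 'v \<Rightarrow> 'v \<Rightarrow> real" and g' :: "'y \<Rightarrow> 'w \<Rightarrow> 'w \<Rightarrow> real" +
  assumes bij: "bij_betw j (fibre B x) (fibre B' (i x))"
begin

definition j_inv :: "'w \<Rightarrow> 'v" where
  "j_inv = inv_into (fibre B x) j"

lemma j_inv_j: "v \<in> fibre B x \<Longrightarrow> j_inv (j v) = v"
  using bij by (simp add: j_inv_def bij_betw_def)

lemma j_j_inv: "w \<in> fibre B' (i x) \<Longrightarrow> j (j_inv w) = w"
  using bij by (simp add: j_inv_def bij_betw_def f_inv_into_f)

lemma j_inv_in: "w \<in> fibre B' (i x) \<Longrightarrow> j_inv w \<in> fibre B x"
  using bij by (metis j_inv_def bij_betw_def inv_into_into)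

lemma word_hom_inverse_left: "t \<in> words_on (lists (fibre B x)) \<Longrightarrow> word_hom j_inv (word_hom j t) = t"
  by (rule word_hom_inverse[of t "fibre B x"]) (simp_all add: j_inv_j)

lemma word_hom_inverse_right: "t \<in> words_on (lists (fibre B' (i x))) \<Longrightarrow> word_hom j (word_hom j_inv t) = t"
  by (rule word_hom_inverse[of t "fibre B' (i x)"]) (simp_all add: j_j_inv)

text \<open>Makes every transport result available in the opposite direction. The base map is
  constant because only the fibre over \<open>i x\<close> is concerned.\<close>

lemma inverse_iso: "fibre_iso B' B (\<lambda>_. x) (i x) j_inv g' g"
proof unfold_locales
  show "j_inv (vadd B' v w) = vadd B (j_inv v) (j_inv w)"
    if "v \<in> fibre B' (i x)" "w \<in> fibre B' (i x)" for v w
    using that by (metis j_inv_j j_j_inv j_inv_in j_vadd source.vadd_closed)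
  show "j_inv (vscale B' a v) = vscale B a (j_inv v)" if "v \<in> fibre B' (i x)" for a v
    using that by (metis j_inv_j j_j_inv j_inv_in j_vscale source.vscale_closed)
  show "g x (j_inv v) (j_inv w) = g' (i x) v w"
    if "v \<in> fibre B' (i x)" "w \<in> fibre B' (i x)" for v w
    using that by (metis j_j_inv j_inv_in j_metric)
  show "bij_betw j_inv (fibre B' (i x)) (fibre B x)"
    unfolding j_inv_def by (rule bij_betw_inv_into[OF bij])
qed (use source.base source.vadd_closed source.vscale_closed target.base target.vadd_closed
      target.vscale_closed j_inv_in in auto)

text \<open>Only the homomorphism part is registered: a full \<open>fibre_iso\<close> would supply
  an inverse of its own, and so on.\<close>

sublocale inverse: fibre_hom B' B "\<lambda>_. x" "i x" j_inv g' g
  using inverse_iso by (simp add: fibre_iso_def)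

lemma inverse_clifford_hom:
  "a \<in> fibre (clifford B g) x \<Longrightarrow> inverse.clifford_hom (clifford_hom a) = a"
  by (elim source.fibre_clifford_cases)
    (simp add: clifford_hom_elem inverse.clifford_hom_elem word_hom_inverse_left)

lemma clifford_hom_inverse:
  "a \<in> fibre (clifford B' g') (i x) \<Longrightarrow> clifford_hom (inverse.clifford_hom a) = a"
  by (elim target.fibre_clifford_cases)
    (simp add: clifford_hom_elem inverse.clifford_hom_elem word_hom_inverse_right)

lemma inverse_ext_hom:
  assumes "e \<in> fibre (ext k B) x"
  shows "inverse.ext_hom k (ext_hom k e) = e"
using assms
proof (elim source.fibre_ext_cases)
  fix t assume e: "e = source.ext_elem k t" and "\<And>n. t n \<in> words_on (homog (fibre B x) n)"
  then have "word_hom j_inv (word_hom j (t n)) = t n" for n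
    using word_hom_inverse_left homog_subset by blast
  then show ?thesis
    by (simp add: e ext_hom_elem inverse.ext_hom_elem)
qed

lemma ext_hom_inverse:
  assumes "e \<in> fibre (ext k B') (i x)"
  shows "ext_hom k (inverse.ext_hom k e) = e"
using assms
proof (elim target.fibre_ext_cases)
  fix t assume e: "e = target.ext_elem k t" and "\<And>n. t n \<in> words_on (homog (fibre B' (i x)) n)"
  then have "word_hom j (word_hom j_inv (t n)) = t n" for n
    using word_hom_inverse_right homog_subset by blast
  then show ?thesis
    by (simp add: e ext_hom_elem inverse.ext_hom_elem)
qed

text \<open>The map induced by \<open>j_inv\<close> is a left inverse. This injectivity evaluates
  the \<open>inv_into\<close> in \<open>Phi_tensor\<close>.\<close>

lemma inj_on_tpow: "inj_on (word_map (multilin B') i j) (fibre (tpow n B) x)"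
proof (rule inj_on_inverseI)
  fix a assume "a \<in> fibre (tpow n B) x"
  then show "word_map (multilin B) (\<lambda>_. x) j_inv (word_map (multilin B') i j a) = a"
    by (auto simp: source.fibre_tpow word_map_multilin inverse.word_map_multilin
        word_hom_inverse_left[OF homog_subset])
qed

text \<open>The new action is the old one conjugated by the induced isomorphisms. The second
  conjunct, that they intertwine the two actions, is what later compares values and yields
  uniqueness.\<close>

lemma clifford_action_transport:
  assumes c: "is_clifford_action k B g x c"
  shows "\<exists>c'. is_clifford_action k B' g' (i x) c' \<and>
    (\<forall>a\<in>fibre (clifford B g) x. \<forall>e\<in>fibre (ext k B) x. c' (clifford_hom a) (ext_hom k e) = ext_hom k (c a e))"
proof -
  let ?C = "fibre (clifford B g) x" and ?C' = "fibre (clifford B' g') (i x)"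
  let ?L = "fibre (ext k B) x" and ?L' = "fibre (ext k B') (i x)"
  \<comment> \<open>The restrictions give the normalisation off the fibres that
    \<open>is_clifford_action\<close> demands.\<close>
  define c' where "c' = (\<lambda>a\<in>?C'. \<lambda>e\<in>?L'. ext_hom k (c (inverse.clifford_hom a) (inverse.ext_hom k e)))"
  have c'_eq: "c' (clifford_hom a) (ext_hom k e) = ext_hom k (c a e)" if "a \<in> ?C" "e \<in> ?L" for a e
    using that by (simp add: c'_def inverse_clifford_hom inverse_ext_hom clifford_hom_in ext_hom_in)
  \<comment> \<open>By surjectivity each condition on \<open>c'\<close> can be checked on images,
    where \<open>c'_eq\<close> computes it.\<close>
  have C': "\<exists>a. a \<in> ?C \<and> a' = clifford_hom a" if "a' \<in> ?C'" for a'
    using that clifford_hom_inverse inverse.clifford_hom_in by metis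
  have L': "\<exists>e. e \<in> ?L \<and> e' = ext_hom k e" if "e' \<in> ?L'" for e'
    using that ext_hom_inverse inverse.ext_hom_in by metis
  note c_defs = c[unfolded is_clifford_action_def Let_def]
  have c_in: "c a e \<in> ?L" if "a \<in> ?C" "e \<in> ?L" for a e
    using that c_defs by (auto simp: PiE_iff)
  have "is_clifford_action k B' g' (i x) c'"
    unfolding is_clifford_action_def Let_def
  proof (intro conjI ballI allI impI)
    show "c' \<in> ?C' \<rightarrow>\<^sub>E ?L' \<rightarrow>\<^sub>E ?L'"
      using c_in by (auto simp: c'_def ext_hom_in inverse.clifford_hom_in inverse.ext_hom_in)
  next
    fix a' e' d' assume "a' \<in> ?C'" "e' \<in> ?L'" "d' \<in> ?L'"
    then obtain a e d where "a \<in> ?C" "a' = clifford_hom a" "e \<in> ?L" "e' = ext_hom k e"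
        "d \<in> ?L" "d' = ext_hom k d"
      using C' L' by metis
    then show "c' a' (vadd (ext k B') e' d') = vadd (ext k B') (c' a' e') (c' a' d')"
      using c_defs by (simp add: c'_eq c_in source.vadd_ext_in ext_hom_vadd[symmetric])
  next
    fix a' e' r assume "a' \<in> ?C'" "e' \<in> ?L'"
    then obtain a e where "a \<in> ?C" "a' = clifford_hom a" "e \<in> ?L" "e' = ext_hom k e"
      using C' L' by metis
    then show "c' a' (vscale (ext k B') r e') = vscale (ext k B') r (c' a' e')"
      using c_defs by (simp add: c'_eq c_in source.vscale_ext_in ext_hom_vscale[symmetric])
  next
    fix a' b' e' assume "a' \<in> ?C'" "b' \<in> ?C'" "e' \<in> ?L'"
    then obtain a b e where ab: "a \<in> ?C" "a' = clifford_hom a" "b \<in> ?C" "b' = clifford_hom b"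
        "e \<in> ?L" "e' = ext_hom k e"
      using C' L' by metis
    then show "c' (vadd (clifford B' g') a' b') e' = vadd (ext k B') (c' a' e') (c' b' e')"
      using c_defs
      by (simp add: c'_eq c_in source.clifford_closed ext_hom_vadd[symmetric] clifford_hom_simps[symmetric])
    from ab show "c' (clifford_mult B' g' a' b') e' = c' a' (c' b' e')"
      using c_defs
      by (simp add: c'_eq c_in source.clifford_closed clifford_hom_simps[symmetric])
  next
    fix a' r e' assume "a' \<in> ?C'" "e' \<in> ?L'"
    then obtain a e where "a \<in> ?C" "a' = clifford_hom a" "e \<in> ?L" "e' = ext_hom k e"
      using C' L' by metis
    \<comment> \<open>\<open>clifford_hom_simps\<close> is stated for two elements throughout, so
      \<open>a\<close> also fills the place of the second one, which the rule for scalars does not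
      mention.\<close>
    then show "c' (vscale (clifford B' g') r a') e' = vscale (ext k B') r (c' a' e')"
      using c_defs
      by (simp add: c'_eq c_in source.clifford_closed ext_hom_vscale[symmetric]
          clifford_hom_simps(2)[of a a, symmetric])
  next
    fix e' assume "e' \<in> ?L'"
    then obtain e where "e \<in> ?L" "e' = ext_hom k e"
      using L' by metis
    then show "c' (clifford_word B' g' (i x) []) e' = e'"
      using c_defs clifford_hom_word[of "[]"] c'_eq[OF source.clifford_word_in[of "[]"]] by simp
  next
    fix v' vs' assume v': "v' \<in> fibre B' (i x)" "vs' \<in> lists (fibre B' (i x))" "length vs' \<le> k"
    \<comment> \<open>Letters are pulled back one at a time, which keeps the length and hence the
      bound \<open>k\<close>; \<open>j_metric\<close> then matches the contraction
      coefficients.\<close>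
    define v vs where "v = j_inv v'" and "vs = map j_inv vs'"
    have v: "v \<in> fibre B x" "v' = j v"
      using v' by (simp_all add: v_def j_inv_in j_j_inv)
    have vs: "vs \<in> lists (fibre B x)" "vs' = map j vs" "length vs \<le> k"
      using v' by (auto simp: vs_def j_inv_in j_j_inv intro!: map_idI[symmetric])
    have nth: "vs ! m \<in> fibre B x" if "m < length vs" for m
      using vs(1) nth_mem[OF that] by (auto simp: in_lists_conv_set)
    have "c' (clifford_word B' g' (i x) [v']) (wedge k B' (i x) (word vs')) =
        ext_hom k (c (clifford_word B g x [v]) (wedge k B x (word vs)))"
      using c'_eq[OF source.clifford_word_in[of "[v]"] source.wedge_in[of "word vs"]] v vs
      by (simp add: clifford_hom_word ext_hom_wedge)
    also have "\<dots> = ext_hom k (wedge k B x (word (v # vs) -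
          (\<Sum>m<length vs. ((-1) ^ m * g x v (vs ! m)) *\<^sub>R word (take m vs @ drop (Suc m) vs))))"
      using c_defs v vs by simp
    also have "\<dots> = wedge k B' (i x) (word (v' # vs') -
          (\<Sum>m<length vs'. ((-1) ^ m * g' (i x) v' (vs' ! m)) *\<^sub>R word (take m vs' @ drop (Suc m) vs')))"
      using v vs by (simp add: ext_hom_wedge j_metric nth take_map drop_map)
    finally show "c' (clifford_word B' g' (i x) [v']) (wedge k B' (i x) (word vs')) =
      wedge k B' (i x) (word (v' # vs') -
          (\<Sum>m<length vs'. ((-1) ^ m * g' (i x) v' (vs' ! m)) *\<^sub>R word (take m vs' @ drop (Suc m) vs')))" .
  qed
  with c'_eq show ?thesis by blast
qed

text \<open>Existence travels along the isometry, uniqueness against it: an action on the target is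
  pulled back by \<open>inverse_iso\<close> to the source, where it must equal
  \<open>c\<close>.\<close>

lemma unique_clifford_action_transport:
  assumes "\<exists>!c. is_clifford_action k B g x c"
  shows "\<exists>!c'. is_clifford_action k B' g' (i x) c'"
    and "\<lbrakk>a \<in> fibre (clifford B g) x; e \<in> fibre (ext k B) x\<rbrakk> \<Longrightarrow>
      (THE c'. is_clifford_action k B' g' (i x) c') (clifford_hom a) (ext_hom k e) =
      ext_hom k ((THE c. is_clifford_action k B g x c) a e)"
proof -
  let ?C' = "fibre (clifford B' g') (i x)" and ?L' = "fibre (ext k B') (i x)"
  obtain c where c: "is_clifford_action k B g x c" "\<And>d. is_clifford_action k B g x d \<Longrightarrow> d = c"
    using assms by blast
  obtain c' where c': "is_clifford_action k B' g' (i x) c'"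
      "\<And>a e. a \<in> fibre (clifford B g) x \<Longrightarrow> e \<in> fibre (ext k B) x \<Longrightarrow>
        c' (clifford_hom a) (ext_hom k e) = ext_hom k (c a e)"
    using clifford_action_transport[OF c(1)] by blast
  have unique: "d' = c'" if d': "is_clifford_action k B' g' (i x) d'" for d'
  proof -
    obtain d where d: "is_clifford_action k B g x d"
      "\<And>a e. a \<in> ?C' \<Longrightarrow> e \<in> ?L' \<Longrightarrow>
        d (inverse.clifford_hom a) (inverse.ext_hom k e) = inverse.ext_hom k (d' a e)"
      using fibre_iso.clifford_action_transport[OF inverse_iso d'] by blast
    have PiE: "d' \<in> ?C' \<rightarrow>\<^sub>E ?L' \<rightarrow>\<^sub>E ?L'" "c' \<in> ?C' \<rightarrow>\<^sub>E ?L' \<rightarrow>\<^sub>E ?L'"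
      using d' c'(1) by (simp_all add: is_clifford_action_def Let_def)
    have "d' a e = c' a e" if a: "a \<in> ?C'" and e: "e \<in> ?L'" for a e
    proof -
      have "d' a e \<in> ?L'" using PiE(1) a e by (auto simp: PiE_iff)
      then have "d' a e = ext_hom k (d (inverse.clifford_hom a) (inverse.ext_hom k e))"
        by (simp add: d(2) a e ext_hom_inverse)
      also have "\<dots> = c' a e"
        using c'(2)[OF inverse.clifford_hom_in inverse.ext_hom_in, OF a e] c(2)[OF d(1)] a e
        by (simp add: clifford_hom_inverse ext_hom_inverse)
      finally show ?thesis .
    qed
    \<comment> \<open>Agreement on the fibres is agreement everywhere, since both functions are
      extensional in each argument.\<close>
    then have "d' a = c' a" if "a \<in> ?C'" for a
      using that PiE by (intro extensionalityI[of _ ?L']) (auto simp: PiE_iff)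
    then show ?thesis
      using PiE by (intro extensionalityI[of _ ?C']) (auto simp: PiE_iff)
  qed
  show "\<exists>!c'. is_clifford_action k B' g' (i x) c'"
    using c'(1) unique by blast
  show "(THE c'. is_clifford_action k B' g' (i x) c') (clifford_hom a) (ext_hom k e) =
      ext_hom k ((THE c. is_clifford_action k B g x c) a e)"
    if "a \<in> fibre (clifford B g) x" "e \<in> fibre (ext k B) x"
    using the_equality[where P = "is_clifford_action k B' g' (i x)", OF c'(1) unique]
      the_equality[where P = "is_clifford_action k B g x", OF c] c'(2)[OF that] by simp
qed

text \<open>The equivalence \<open>iff\<close> puts both sides into the same branch of the
  definition. In the default branch both are zero vectors, matched by
  \<open>ext_hom_vzero\<close>.\<close>

lemma clifford_action_hom:
  assumes "a \<in> fibre (clifford B g) x" "e \<in> fibre (ext k B) x"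
  shows "clifford_action k B' g' (clifford_hom a) (ext_hom k e) = ext_hom k (clifford_action k B g a e)"
proof -
  have proj: "proj (clifford B g) a = x" "proj (clifford B' g') (clifford_hom a) = i x"
    using assms(1) clifford_hom_in[OF assms(1)] by (auto simp: fibre_def over_def)
  have iff: "(\<exists>!c. is_clifford_action k B g x c) \<longleftrightarrow> (\<exists>!c'. is_clifford_action k B' g' (i x) c')"
    by (rule iffI) (erule unique_clifford_action_transport(1)
      fibre_iso.unique_clifford_action_transport(1)[OF inverse_iso])+
  show ?thesis
  proof (cases "\<exists>!c. is_clifford_action k B g x c")
    case True
    then show ?thesis
      using iff assms unique_clifford_action_transport(2)
      by (simp add: clifford_action_def proj del: proj_clifford)
  next
    case False
    then have "\<not> (\<exists>!c'. is_clifford_action k B' g' (i x) c')"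
      using iff by blast
    with False show ?thesis
      by (simp only: clifford_action_def proj Let_def if_False ext_hom_vzero)
  qed
qed

text \<open>The formulas for \<open>Phi_ext\<close> hold on fibres, so the value of the action must
  be seen to stay there, whichever branch defines it.\<close>

lemma clifford_action_in:
  assumes "a \<in> fibre (clifford B g) x" "e \<in> fibre (ext k B) x"
  shows "clifford_action k B g a e \<in> fibre (ext k B) x"
proof -
  have proj: "proj (clifford B g) a = x"
    using assms(1) by (auto simp: fibre_def over_def)
  have "vzero (ext k B) x = source.ext_elem k (\<lambda>_. 0)"
    by (simp add: source.vzero_ext source.ext_elem_def linear_0[OF linear_alt])
  then have zero: "vzero (ext k B) x \<in> fibre (ext k B) x"
    by (simp add: source.ext_elem_in words_on_intros)
  have the: "(THE c. is_clifford_action k B g x c) a e \<in> fibre (ext k B) x"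
    if "\<exists>!c. is_clifford_action k B g x c"
    using theI'[OF that] assms by (auto simp: is_clifford_action_def Let_def PiE_iff)
  show ?thesis
    unfolding clifford_action_def proj Let_def using zero the by (simp only: split: if_split) blast
qed

end


section \<open>Gluing\<close>

text \<open>Each gluing class contains exactly one normalised element.\<close>

definition glue_norm :: "'a set \<Rightarrow> ('a \<Rightarrow> 'b) \<Rightarrow> 'a + 'b \<Rightarrow> 'a + 'b" where
  "glue_norm Z h = case_sum (\<lambda>z. if z \<in> Z then Inr (h z) else Inl z) Inr"

text \<open>A generating step leaves the normal form unchanged, and every element reaches its own in
  at most one step; this replaces an analysis of chains.\<close>

lemma equivclp_glue_iff:
  "equivclp (\<lambda>a b. \<exists>z\<in>Z. a = Inl z \<and> b = Inr (h z)) a b \<longleftrightarrow> glue_norm Z h a = glue_norm Z h b"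
  (is "equivclp ?r a b \<longleftrightarrow> _")
proof
  assume "equivclp ?r a b"
  then show "glue_norm Z h a = glue_norm Z h b"
    by (induction rule: equivclp_induct) (auto simp: glue_norm_def)
next
  have norm: "equivclp ?r a (glue_norm Z h a)" for a
    by (cases a) (auto simp: glue_norm_def intro!: r_into_equivclp)
  assume "glue_norm Z h a = glue_norm Z h b"
  then have "equivclp ?r a (glue_norm Z h b)"
    using norm[of a] by simp
  then show "equivclp ?r a b"
    by (rule equivclp_trans) (rule equivclp_sym, rule norm)
qed

lemma glue_class_eq:
  "a \<in> pts D <+> pts E \<Longrightarrow>
   glue_class D E Z h a = {b \<in> pts D <+> pts E. glue_norm Z h b = glue_norm Z h a}"
  unfolding glue_class_def glue_rel_def equivclp_glue_iff by auto

lemma Inr_in_incl2: "b \<in> pts E \<Longrightarrow> Inr b' \<in> incl2 D E Z h b \<longleftrightarrow> b' = b"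
  by (auto simp: incl2_def glue_class_eq InrI glue_norm_def)

lemma incl1_eq: "a \<in> pts D \<Longrightarrow> a \<notin> Z \<Longrightarrow> incl1 D E Z h a = {Inl a}"
  by (auto simp: incl1_def glue_class_eq InlI glue_norm_def split: if_splits)

lemma incl1_eq_incl2: "z \<in> pts D \<Longrightarrow> z \<in> Z \<Longrightarrow> h z \<in> pts E \<Longrightarrow> incl1 D E Z h z = incl2 D E Z h (h z)"
  by (simp add: incl1_def incl2_def glue_class_eq InlI InrI glue_norm_def)

lemma out2_incl2: "b \<in> pts E \<Longrightarrow> out2 (incl2 D E Z h b) = b"
  by (simp add: out2_def Inr_in_incl2)

lemma out1_incl1: "a \<in> pts D \<Longrightarrow> a \<notin> Z \<Longrightarrow> out1 (incl1 D E Z h a) = a"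
  by (simp add: out1_def incl1_eq)

lemma glue_case_incl2: "b \<in> pts E \<Longrightarrow> glue_case F G (incl2 D E Z h b) = G b"
  by (simp add: glue_case_def Inr_in_incl2 out2_incl2)

lemma glue_case_incl1: "a \<in> pts D \<Longrightarrow> a \<notin> Z \<Longrightarrow> glue_case F G (incl1 D E Z h a) = F a"
  unfolding glue_case_def by (simp add: out1_incl1) (simp add: incl1_eq)

lemma incl1_neq_incl2: "a \<in> pts D \<Longrightarrow> a \<notin> Z \<Longrightarrow> b \<in> pts E \<Longrightarrow> incl1 D E Z h a \<noteq> incl2 D E Z h b"
  using Inr_in_incl2[of b E b D Z h] by (auto simp: incl1_eq)

lemma incl1_in: "a \<in> pts D \<Longrightarrow> incl1 D E Z h a \<in> pts (glue_sp D E Z h)"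
  and incl2_in: "b \<in> pts E \<Longrightarrow> incl2 D E Z h b \<in> pts (glue_sp D E Z h)"
  by (auto simp: glue_sp_def pushforward_def sum_sp_def incl1_def incl2_def)

text \<open>A point of \<open>Z\<close> is moved to the second alternative through its image under
  \<open>h\<close>, so the alternatives match the branches of \<open>glue_case\<close>.\<close>

lemma glue_sp_cases:
  assumes "c \<in> pts (glue_sp D E Z h)" "\<And>z. z \<in> Z \<Longrightarrow> h z \<in> pts E"
  obtains a where "a \<in> pts D" "a \<notin> Z" "c = incl1 D E Z h a"
    | b where "b \<in> pts E" "c = incl2 D E Z h b"
proof -
  from assms(1) consider a where "a \<in> pts D" "c = incl1 D E Z h a" | b where "b \<in> pts E" "c = incl2 D E Z h b"
    by (auto simp: glue_sp_def pushforward_def sum_sp_def incl1_def incl2_def)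
  then show thesis
  proof cases
    case (1 a)
    then show thesis
      using that(1)[of a] that(2)[of "h a"] incl1_eq_incl2[of a D Z h E] assms(2)[of a] by blast
  next
    case (2 b)
    then show thesis by (rule that(2))
  qed
qed

section \<open>Fibres of a glued bundle\<close>

lemma base_glue: "base (glue V\<^sub>1 V\<^sub>2 Y f h) = glue_sp (base V\<^sub>1) (base V\<^sub>2) Y f"
  and tot_glue: "tot (glue V\<^sub>1 V\<^sub>2 Y f h) = glue_sp (tot V\<^sub>1) (tot V\<^sub>2) (over V\<^sub>1 Y) h"
  by (simp_all add: glue_def)

lemma fibre_iff: "v \<in> fibre V x \<longleftrightarrow> v \<in> pts (tot V) \<and> proj V v = x"
  by (simp add: fibre_def over_def)

lemma over_iff: "v \<in> over V W \<longleftrightarrow> v \<in> pts (tot V) \<and> proj V v \<in> W"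
  by (simp add: over_def)

lemma proj_glue_incl1:
  "v \<in> pts (tot V\<^sub>1) \<Longrightarrow> proj V\<^sub>1 v \<notin> Y \<Longrightarrow>
   proj (glue V\<^sub>1 V\<^sub>2 Y f h) (j\<^sub>1 V\<^sub>1 V\<^sub>2 Y h v) = i\<^sub>1 V\<^sub>1 V\<^sub>2 Y f (proj V\<^sub>1 v)"
  by (simp add: glue_def glue_case_incl1 over_iff)

lemma proj_glue_incl2:
  "v \<in> pts (tot V\<^sub>2) \<Longrightarrow>
   proj (glue V\<^sub>1 V\<^sub>2 Y f h) (j\<^sub>2 V\<^sub>1 V\<^sub>2 Y h v) = i\<^sub>2 V\<^sub>1 V\<^sub>2 Y f (proj V\<^sub>2 v)"
  by (simp add: glue_def glue_case_incl2)

text \<open>Only set-level data are recorded, so that the same facts serve the given bundles and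
  their Clifford bundles.\<close>

locale bundle_gluing =
  fixes V\<^sub>1 :: "('v, 'x) pbundle" and V\<^sub>2 :: "('w, 'y) pbundle"
    and Y :: "'x set" and f :: "'x \<Rightarrow> 'y" and h :: "'v \<Rightarrow> 'w"
  assumes proj1_in: "\<And>v. v \<in> pts (tot V\<^sub>1) \<Longrightarrow> proj V\<^sub>1 v \<in> pts (base V\<^sub>1)"
    and proj2_in: "\<And>v. v \<in> pts (tot V\<^sub>2) \<Longrightarrow> proj V\<^sub>2 v \<in> pts (base V\<^sub>2)"
    and f_in: "\<And>y. y \<in> Y \<Longrightarrow> f y \<in> pts (base V\<^sub>2)"
    and h_in: "\<And>v. v \<in> over V\<^sub>1 Y \<Longrightarrow> h v \<in> pts (tot V\<^sub>2)"
begin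

abbreviation "V \<equiv> glue V\<^sub>1 V\<^sub>2 Y f h"

lemma tot_cases:
  assumes "c \<in> pts (tot V)"
  obtains v where "v \<in> pts (tot V\<^sub>1)" "proj V\<^sub>1 v \<notin> Y" "c = j\<^sub>1 V\<^sub>1 V\<^sub>2 Y h v"
      "proj V c = i\<^sub>1 V\<^sub>1 V\<^sub>2 Y f (proj V\<^sub>1 v)"
    | v where "v \<in> pts (tot V\<^sub>2)" "c = j\<^sub>2 V\<^sub>1 V\<^sub>2 Y h v"
      "proj V c = i\<^sub>2 V\<^sub>1 V\<^sub>2 Y f (proj V\<^sub>2 v)"
  using assms[unfolded tot_glue] h_in
proof (rule glue_sp_cases, goal_cases)
  case (2 v)
  then show ?thesis using that(1)[of v] proj_glue_incl1[of v V\<^sub>1 Y V\<^sub>2 f h] by (simp add: over_iff)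
next
  case (3 v)
  then show ?thesis using that(2)[of v] proj_glue_incl2[of v V\<^sub>2 V\<^sub>1 Y f h] by simp
qed

lemma base_cases:
  assumes "x \<in> pts (base V)"
  obtains x\<^sub>1 where "x\<^sub>1 \<in> pts (base V\<^sub>1)" "x\<^sub>1 \<notin> Y" "x = i\<^sub>1 V\<^sub>1 V\<^sub>2 Y f x\<^sub>1"
    | x\<^sub>2 where "x\<^sub>2 \<in> pts (base V\<^sub>2)" "x = i\<^sub>2 V\<^sub>1 V\<^sub>2 Y f x\<^sub>2"
  using assms that f_in unfolding base_glue by (elim glue_sp_cases)

text \<open>Off \<open>Y\<close> the classes are singletons, whence injectivity. Nothing from
  \<open>V\<^sub>2\<close> lies over this point, because the base inclusions have disjoint images
  there; this gives surjectivity.\<close>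

lemma fibre_incl1:
  assumes "x \<in> pts (base V\<^sub>1)" "x \<notin> Y"
  shows "bij_betw (j\<^sub>1 V\<^sub>1 V\<^sub>2 Y h) (fibre V\<^sub>1 x) (fibre V (i\<^sub>1 V\<^sub>1 V\<^sub>2 Y f x))"
proof (rule bij_betwI')
  fix v w assume "v \<in> fibre V\<^sub>1 x" "w \<in> fibre V\<^sub>1 x"
  then show "(j\<^sub>1 V\<^sub>1 V\<^sub>2 Y h v = j\<^sub>1 V\<^sub>1 V\<^sub>2 Y h w) = (v = w)"
    using assms by (simp add: fibre_iff over_iff incl1_eq)
next
  fix v assume "v \<in> fibre V\<^sub>1 x"
  then show "j\<^sub>1 V\<^sub>1 V\<^sub>2 Y h v \<in> fibre V (i\<^sub>1 V\<^sub>1 V\<^sub>2 Y f x)"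
    using assms by (auto simp: fibre_iff proj_glue_incl1) (simp add: tot_glue incl1_in)
next
  fix c assume c: "c \<in> fibre V (i\<^sub>1 V\<^sub>1 V\<^sub>2 Y f x)"
  then have "c \<in> pts (tot V)" by (simp add: fibre_iff)
  then show "\<exists>v\<in>fibre V\<^sub>1 x. c = j\<^sub>1 V\<^sub>1 V\<^sub>2 Y h v"
  proof (cases rule: tot_cases)
    case (1 v)
    then have "i\<^sub>1 V\<^sub>1 V\<^sub>2 Y f (proj V\<^sub>1 v) = i\<^sub>1 V\<^sub>1 V\<^sub>2 Y f x"
      using c by (simp add: fibre_iff)
    then have "proj V\<^sub>1 v = x"
      using 1 assms by (simp add: incl1_eq proj1_in)
    with 1 show ?thesis by (auto simp: fibre_iff)
  next
    case (2 v)
    then have "i\<^sub>1 V\<^sub>1 V\<^sub>2 Y f x = i\<^sub>2 V\<^sub>1 V\<^sub>2 Y f (proj V\<^sub>2 v)"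
      using c by (simp add: fibre_iff)
    with incl1_neq_incl2[OF assms proj2_in[OF 2(1)]] show ?thesis by blast
  qed
qed

text \<open>\<open>out2\<close> inverts the inclusion of total spaces, for injectivity, and that of
  bases, which places a preimage over \<open>x\<close>.\<close>

lemma fibre_incl2:
  assumes "x \<in> pts (base V\<^sub>2)"
  shows "bij_betw (j\<^sub>2 V\<^sub>1 V\<^sub>2 Y h) (fibre V\<^sub>2 x) (fibre V (i\<^sub>2 V\<^sub>1 V\<^sub>2 Y f x))"
proof (rule bij_betwI')
  fix v w assume "v \<in> fibre V\<^sub>2 x" "w \<in> fibre V\<^sub>2 x"
  then show "(j\<^sub>2 V\<^sub>1 V\<^sub>2 Y h v = j\<^sub>2 V\<^sub>1 V\<^sub>2 Y h w) = (v = w)"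
    by (metis fibre_iff out2_incl2)
next
  fix v assume "v \<in> fibre V\<^sub>2 x"
  then show "j\<^sub>2 V\<^sub>1 V\<^sub>2 Y h v \<in> fibre V (i\<^sub>2 V\<^sub>1 V\<^sub>2 Y f x)"
    by (auto simp: fibre_iff proj_glue_incl2) (simp add: tot_glue incl2_in)
next
  fix c assume c: "c \<in> fibre V (i\<^sub>2 V\<^sub>1 V\<^sub>2 Y f x)"
  then have "c \<in> pts (tot V)" by (simp add: fibre_iff)
  then show "\<exists>v\<in>fibre V\<^sub>2 x. c = j\<^sub>2 V\<^sub>1 V\<^sub>2 Y h v"
  proof (cases rule: tot_cases)
    case (1 v)
    then have "i\<^sub>1 V\<^sub>1 V\<^sub>2 Y f (proj V\<^sub>1 v) = i\<^sub>2 V\<^sub>1 V\<^sub>2 Y f x"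
      using c by (simp add: fibre_iff)
    with incl1_neq_incl2[OF proj1_in[OF 1(1)] 1(2) assms] show ?thesis by blast
  next
    case (2 v)
    then have "i\<^sub>2 V\<^sub>1 V\<^sub>2 Y f (proj V\<^sub>2 v) = i\<^sub>2 V\<^sub>1 V\<^sub>2 Y f x"
      using c by (simp add: fibre_iff)
    then have "proj V\<^sub>2 v = x"
      using out2_incl2[OF proj2_in[OF 2(1)]] out2_incl2[OF assms] by metis
    with 2 show ?thesis by (auto simp: fibre_iff)
  qed
qed

end

lemma pseudo_bundle_fibre:
  assumes "pseudo_bundle B" "x \<in> pts (base B)"
  shows "bundle_fibre B x"
proof -
  have "pts (space (fibre_space B x)) = fibre B x"
    by (auto simp: fibre_space_def subsp_def fibre_iff)
  moreover have "vec_space (fibre_space B x)"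
    using assms by (simp add: pseudo_bundle_def)
  ultimately show ?thesis
    using assms(2) by unfold_locales (simp_all add: vec_space_def Let_def, simp_all add: fibre_space_def)
qed

locale metric_gluing =
  fixes V\<^sub>1 :: "('v, 'x) pbundle" and V\<^sub>2 :: "('w, 'y) pbundle"
    and Y :: "'x set" and f :: "'x \<Rightarrow> 'y" and h :: "'v \<Rightarrow> 'w"
    and g\<^sub>1 :: "'x \<Rightarrow> 'v \<Rightarrow> 'v \<Rightarrow> real" and g\<^sub>2 :: "'y \<Rightarrow> 'w \<Rightarrow> 'w \<Rightarrow> real"
  assumes pseudo_bundles: "pseudo_bundle V\<^sub>1" "pseudo_bundle V\<^sub>2"
    and gluing: "gluing V\<^sub>1 V\<^sub>2 Y f h"
    and compatible: "compatible_metrics V\<^sub>1 Y f h g\<^sub>1 g\<^sub>2"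
begin

sublocale bundle_gluing V\<^sub>1 V\<^sub>2 Y f h
proof
  show "proj V\<^sub>1 v \<in> pts (base V\<^sub>1)" if "v \<in> pts (tot V\<^sub>1)" for v
    using that pseudo_bundles(1) by (auto simp: pseudo_bundle_def)
  show "proj V\<^sub>2 v \<in> pts (base V\<^sub>2)" if "v \<in> pts (tot V\<^sub>2)" for v
    using that pseudo_bundles(2) by (auto simp: pseudo_bundle_def)
  show "f y \<in> pts (base V\<^sub>2)" if "y \<in> Y" for y
    using that gluing by (auto simp: gluing_def dsmooth_def subsp_def)
  show "h v \<in> pts (tot V\<^sub>2)" if "v \<in> over V\<^sub>1 Y" for v
    using that gluing by (auto simp: gluing_def dsmooth_def subsp_def over_iff)
qed

abbreviation "g \<equiv> glue_metric g\<^sub>1 g\<^sub>2"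

lemma bundle_fibre1: "x \<in> pts (base V\<^sub>1) \<Longrightarrow> bundle_fibre V\<^sub>1 x"
  and bundle_fibre2: "x' \<in> pts (base V\<^sub>2) \<Longrightarrow> bundle_fibre V\<^sub>2 x'"
  using pseudo_bundles by (simp_all add: pseudo_bundle_fibre)

text \<open>For \<open>h\<close>, the condition \<open>j_metric\<close> is the compatibility of the
  metrics. This instance shows that \<open>F_Cl\<close> maps into the second Clifford
  bundle.\<close>

lemma fibre_hom_h:
  assumes "y \<in> Y"
  shows "fibre_hom V\<^sub>1 V\<^sub>2 f y h g\<^sub>1 g\<^sub>2"
proof -
  have "y \<in> pts (base V\<^sub>1)"
    using assms gluing by (auto simp: gluing_def)
  then interpret source: bundle_fibre V\<^sub>1 y + target: bundle_fibre V\<^sub>2 "f y"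
    using assms f_in by (simp_all add: bundle_fibre1 bundle_fibre2)
  show ?thesis
  proof
    show "h v \<in> fibre V\<^sub>2 (f y)" if "v \<in> fibre V\<^sub>1 y" for v
      using that assms gluing h_in[of v] by (auto simp: gluing_def fibre_iff over_iff)
  qed (use assms gluing compatible in \<open>auto simp: gluing_def compatible_metrics_def\<close>)
qed

lemma fibre_iso_j1:
  assumes x: "x \<in> pts (base V\<^sub>1)" "x \<notin> Y"
  shows "fibre_iso V\<^sub>1 V (i\<^sub>1 V\<^sub>1 V\<^sub>2 Y f) x (j\<^sub>1 V\<^sub>1 V\<^sub>2 Y h) g\<^sub>1 g"
proof -
  interpret source: bundle_fibre V\<^sub>1 x
    using x by (simp add: bundle_fibre1)
  note bij = fibre_incl1[OF x]
  have fibre: "fibre V (i\<^sub>1 V\<^sub>1 V\<^sub>2 Y f x) = j\<^sub>1 V\<^sub>1 V\<^sub>2 Y h ` fibre V\<^sub>1 x"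
    using bij by (simp add: bij_betw_def)
  have ops: "vadd V (j\<^sub>1 V\<^sub>1 V\<^sub>2 Y h v) (j\<^sub>1 V\<^sub>1 V\<^sub>2 Y h w) = j\<^sub>1 V\<^sub>1 V\<^sub>2 Y h (vadd V\<^sub>1 v w)"
    "vscale V a (j\<^sub>1 V\<^sub>1 V\<^sub>2 Y h v) = j\<^sub>1 V\<^sub>1 V\<^sub>2 Y h (vscale V\<^sub>1 a v)"
    "g (i\<^sub>1 V\<^sub>1 V\<^sub>2 Y f x) (j\<^sub>1 V\<^sub>1 V\<^sub>2 Y h v) (j\<^sub>1 V\<^sub>1 V\<^sub>2 Y h w) = g\<^sub>1 x v w"
    if "v \<in> fibre V\<^sub>1 x" "w \<in> fibre V\<^sub>1 x" for v w a
    using that x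
    by (simp_all add: glue_def glue_metric_def glue_case_incl1 out1_incl1 fibre_iff over_iff)
  show ?thesis
    by unfold_locales
      (use x bij ops in \<open>auto simp: fibre base_glue incl1_in source.vadd_closed source.vscale_closed\<close>)
qed

lemma fibre_iso_j2:
  assumes x: "x \<in> pts (base V\<^sub>2)"
  shows "fibre_iso V\<^sub>2 V (i\<^sub>2 V\<^sub>1 V\<^sub>2 Y f) x (j\<^sub>2 V\<^sub>1 V\<^sub>2 Y h) g\<^sub>2 g"
proof -
  interpret source: bundle_fibre V\<^sub>2 x
    using x by (simp add: bundle_fibre2)
  note bij = fibre_incl2[OF x]
  have fibre: "fibre V (i\<^sub>2 V\<^sub>1 V\<^sub>2 Y f x) = j\<^sub>2 V\<^sub>1 V\<^sub>2 Y h ` fibre V\<^sub>2 x"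
    using bij by (simp add: bij_betw_def)
  have ops: "vadd V (j\<^sub>2 V\<^sub>1 V\<^sub>2 Y h v) (j\<^sub>2 V\<^sub>1 V\<^sub>2 Y h w) = j\<^sub>2 V\<^sub>1 V\<^sub>2 Y h (vadd V\<^sub>2 v w)"
    "vscale V a (j\<^sub>2 V\<^sub>1 V\<^sub>2 Y h v) = j\<^sub>2 V\<^sub>1 V\<^sub>2 Y h (vscale V\<^sub>2 a v)"
    "g (i\<^sub>2 V\<^sub>1 V\<^sub>2 Y f x) (j\<^sub>2 V\<^sub>1 V\<^sub>2 Y h v) (j\<^sub>2 V\<^sub>1 V\<^sub>2 Y h w) = g\<^sub>2 x v w"
    if "v \<in> fibre V\<^sub>2 x" "w \<in> fibre V\<^sub>2 x" for v w a
    using that x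
    by (simp_all add: glue_def glue_metric_def glue_case_incl2 out2_incl2 fibre_iff)
  show ?thesis
    by unfold_locales
      (use x bij ops in \<open>auto simp: fibre base_glue incl2_in source.vadd_closed source.vscale_closed\<close>)
qed

end

lemma inj_on_dsum_map:
  assumes "\<And>n. n \<le> k \<Longrightarrow> inj_on (\<Phi> n) (A n)"
  shows "inj_on (dsum_map k \<Phi>) (\<Pi>\<^sub>E n\<in>{..k}. A n)"
proof (rule inj_onI)
  fix s t assume s: "s \<in> (\<Pi>\<^sub>E n\<in>{..k}. A n)" and t: "t \<in> (\<Pi>\<^sub>E n\<in>{..k}. A n)"
    and eq: "dsum_map k \<Phi> s = dsum_map k \<Phi> t"
  show "s = t"
  proof (rule PiE_ext[OF s t])
    fix n assume n: "n \<in> {..k}"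
    then have "\<Phi> n (s n) = \<Phi> n (t n)"
      using fun_cong[OF eq, of n] by (simp add: dsum_map_def)
    then show "s n = t n"
      using n s t assms[of n] by (auto simp: inj_on_def PiE_iff)
  qed
qed

section \<open>The natural identifications on fibres, and the glued action\<close>

context metric_gluing
begin

abbreviation "H\<^sub>T \<equiv> word_map (multilin V\<^sub>2) f h"
abbreviation "H\<^sub>\<Lambda> k \<equiv> tensor_sum_map k V\<^sub>2 f h"

sublocale clifford: bundle_gluing "clifford V\<^sub>1 g\<^sub>1" "clifford V\<^sub>2 g\<^sub>2" Y f "F_Cl V\<^sub>2 g\<^sub>2 f h"
proof
  show "F_Cl V\<^sub>2 g\<^sub>2 f h a \<in> pts (tot (clifford V\<^sub>2 g\<^sub>2))" if "a \<in> over (clifford V\<^sub>1 g\<^sub>1) Y" for a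
  proof -
    define y where "y = proj (clifford V\<^sub>1 g\<^sub>1) a"
    then have a: "y \<in> Y" "a \<in> fibre (clifford V\<^sub>1 g\<^sub>1) y"
      using that by (simp_all add: over_iff fibre_iff)
    interpret hom: fibre_hom V\<^sub>1 V\<^sub>2 f y h g\<^sub>1 g\<^sub>2
      by (rule fibre_hom_h[OF a(1)])
    show ?thesis
      using hom.clifford_hom_in[OF a(2)] by (simp add: hom.clifford_hom_def F_Cl_def fibre_iff)
  qed
qed (auto simp: clifford_def quot_bundle_def clifford_sp_def f_in[simplified])

lemma Phi_Cl_incl1:
  assumes "a \<in> pts (tot (clifford V\<^sub>1 g\<^sub>1))" "proj (clifford V\<^sub>1 g\<^sub>1) a \<notin> Y"
  shows "Phi_Cl V\<^sub>1 V\<^sub>2 Y f h g\<^sub>1 g\<^sub>2 (j\<^sub>1 (clifford V\<^sub>1 g\<^sub>1) (clifford V\<^sub>2 g\<^sub>2) Y (F_Cl V\<^sub>2 g\<^sub>2 f h) a) =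
    word_map (clifford_rel V g) (i\<^sub>1 V\<^sub>1 V\<^sub>2 Y f) (j\<^sub>1 V\<^sub>1 V\<^sub>2 Y h) a"
  using assms by (simp add: Phi_Cl_def Let_def glue_case_incl1 over_iff)

lemma Phi_Cl_incl2:
  assumes "a \<in> pts (tot (clifford V\<^sub>2 g\<^sub>2))"
  shows "Phi_Cl V\<^sub>1 V\<^sub>2 Y f h g\<^sub>1 g\<^sub>2 (j\<^sub>2 (clifford V\<^sub>1 g\<^sub>1) (clifford V\<^sub>2 g\<^sub>2) Y (F_Cl V\<^sub>2 g\<^sub>2 f h) a) =
    word_map (clifford_rel V g) (i\<^sub>2 V\<^sub>1 V\<^sub>2 Y f) (j\<^sub>2 V\<^sub>1 V\<^sub>2 Y h) a"
  using assms by (simp add: Phi_Cl_def Let_def glue_case_incl2)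

text \<open>Confines two elements with the same image to a single fibre.\<close>

lemma proj_Phi_Cl:
  assumes "c \<in> pts (tot (glue_clifford V\<^sub>1 V\<^sub>2 Y f h g\<^sub>1 g\<^sub>2))"
  shows "fst (Phi_Cl V\<^sub>1 V\<^sub>2 Y f h g\<^sub>1 g\<^sub>2 c) = proj (glue_clifford V\<^sub>1 V\<^sub>2 Y f h g\<^sub>1 g\<^sub>2) c"
proof -
  from assms[unfolded glue_clifford_def] show ?thesis
  proof (cases rule: clifford.tot_cases)
    case (1 a)
    then show ?thesis
      using Phi_Cl_incl1[OF 1(1,2)] by (simp add: fst_word_map glue_clifford_def)
  next
    case (2 a)
    then show ?thesis
      using Phi_Cl_incl2[OF 2(1)] by (simp add: fst_word_map glue_clifford_def)
  qed
qed

text \<open>The common base point determines the fibre and with it the branch; within a fibre the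
  inverse isometry induces a left inverse.\<close>

lemma inj_on_Phi_Cl:
  "inj_on (Phi_Cl V\<^sub>1 V\<^sub>2 Y f h g\<^sub>1 g\<^sub>2) (pts (tot (glue_clifford V\<^sub>1 V\<^sub>2 Y f h g\<^sub>1 g\<^sub>2)))"
proof (rule inj_onI)
  let ?\<Phi> = "Phi_Cl V\<^sub>1 V\<^sub>2 Y f h g\<^sub>1 g\<^sub>2" and ?C = "glue_clifford V\<^sub>1 V\<^sub>2 Y f h g\<^sub>1 g\<^sub>2"
  fix c d assume c: "c \<in> pts (tot ?C)" and d: "d \<in> pts (tot ?C)" and eq: "?\<Phi> c = ?\<Phi> d"
  have proj: "proj ?C d = proj ?C c"
    using proj_Phi_Cl[OF c] proj_Phi_Cl[OF d] eq by simp
  from c show "c = d"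
    unfolding glue_clifford_def
  proof (cases rule: clifford.tot_cases)
    case (1 a)
    define x where "x = proj (clifford V\<^sub>1 g\<^sub>1) a"
    have x: "x \<in> pts (base V\<^sub>1)" "x \<notin> Y" "a \<in> fibre (clifford V\<^sub>1 g\<^sub>1) x"
      using 1 clifford.proj1_in[of a] by (simp_all add: x_def fibre_iff)
    interpret iso: fibre_iso V\<^sub>1 V "i\<^sub>1 V\<^sub>1 V\<^sub>2 Y f" x "j\<^sub>1 V\<^sub>1 V\<^sub>2 Y h" g\<^sub>1 g
      by (rule fibre_iso_j1[OF x(1,2)])
    \<comment> \<open>Lying in the same fibre as \<open>c\<close>, \<open>d\<close> also comes from
      the first bundle.\<close>
    have "d \<in> fibre ?C (i\<^sub>1 V\<^sub>1 V\<^sub>2 Y f x)"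
      using d proj 1(4) by (simp add: fibre_iff x_def glue_clifford_def)
    then obtain b where b: "b \<in> fibre (clifford V\<^sub>1 g\<^sub>1) x"
        "d = j\<^sub>1 (clifford V\<^sub>1 g\<^sub>1) (clifford V\<^sub>2 g\<^sub>2) Y (F_Cl V\<^sub>2 g\<^sub>2 f h) b"
      using bij_betw_imp_surj_on[OF clifford.fibre_incl1[of x]] x
      unfolding glue_clifford_def base_clifford by blast
    have "?\<Phi> c = iso.clifford_hom a" "?\<Phi> d = iso.clifford_hom b"
      using 1(1-3) b x Phi_Cl_incl1[of a] Phi_Cl_incl1[of b]
      by (simp_all add: iso.clifford_hom_def fibre_iff)
    then show ?thesis
      using eq iso.inverse_clifford_hom[OF x(3)] iso.inverse_clifford_hom[OF b(1)] 1(3) b(2) by metis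
  next
    case (2 a)
    define x where "x = proj (clifford V\<^sub>2 g\<^sub>2) a"
    have x: "x \<in> pts (base V\<^sub>2)" "a \<in> fibre (clifford V\<^sub>2 g\<^sub>2) x"
      using 2 clifford.proj2_in[of a] by (simp_all add: x_def fibre_iff)
    interpret iso: fibre_iso V\<^sub>2 V "i\<^sub>2 V\<^sub>1 V\<^sub>2 Y f" x "j\<^sub>2 V\<^sub>1 V\<^sub>2 Y h" g\<^sub>2 g
      by (rule fibre_iso_j2[OF x(1)])
    have "d \<in> fibre ?C (i\<^sub>2 V\<^sub>1 V\<^sub>2 Y f x)"
      using d proj 2(3) by (simp add: fibre_iff x_def glue_clifford_def)
    then obtain b where b: "b \<in> fibre (clifford V\<^sub>2 g\<^sub>2) x"
        "d = j\<^sub>2 (clifford V\<^sub>1 g\<^sub>1) (clifford V\<^sub>2 g\<^sub>2) Y (F_Cl V\<^sub>2 g\<^sub>2 f h) b"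
      using bij_betw_imp_surj_on[OF clifford.fibre_incl2[of x]] x
      unfolding glue_clifford_def base_clifford by blast
    have "?\<Phi> c = iso.clifford_hom a" "?\<Phi> d = iso.clifford_hom b"
      using 2(1-2) b Phi_Cl_incl2[of a] Phi_Cl_incl2[of b]
      by (simp_all add: iso.clifford_hom_def fibre_iff)
    then show ?thesis
      using eq iso.inverse_clifford_hom[OF x(2)] iso.inverse_clifford_hom[OF b(1)] 2(2) b(2) by metis
  qed
qed

lemma inv_Phi_Cl_incl1:
  assumes "a \<in> pts (tot (clifford V\<^sub>1 g\<^sub>1))" "proj (clifford V\<^sub>1 g\<^sub>1) a \<notin> Y"
  shows "inv_into (pts (tot (glue_clifford V\<^sub>1 V\<^sub>2 Y f h g\<^sub>1 g\<^sub>2))) (Phi_Cl V\<^sub>1 V\<^sub>2 Y f h g\<^sub>1 g\<^sub>2)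
      (word_map (clifford_rel V g) (i\<^sub>1 V\<^sub>1 V\<^sub>2 Y f) (j\<^sub>1 V\<^sub>1 V\<^sub>2 Y h) a) =
    j\<^sub>1 (clifford V\<^sub>1 g\<^sub>1) (clifford V\<^sub>2 g\<^sub>2) Y (F_Cl V\<^sub>2 g\<^sub>2 f h) a"
  by (rule inv_into_f_eq[OF inj_on_Phi_Cl _ Phi_Cl_incl1[OF assms]])
    (simp add: glue_clifford_def tot_glue incl1_in assms)

lemma inv_Phi_Cl_incl2:
  assumes "a \<in> pts (tot (clifford V\<^sub>2 g\<^sub>2))"
  shows "inv_into (pts (tot (glue_clifford V\<^sub>1 V\<^sub>2 Y f h g\<^sub>1 g\<^sub>2))) (Phi_Cl V\<^sub>1 V\<^sub>2 Y f h g\<^sub>1 g\<^sub>2)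
      (word_map (clifford_rel V g) (i\<^sub>2 V\<^sub>1 V\<^sub>2 Y f) (j\<^sub>2 V\<^sub>1 V\<^sub>2 Y h) a) =
    j\<^sub>2 (clifford V\<^sub>1 g\<^sub>1) (clifford V\<^sub>2 g\<^sub>2) Y (F_Cl V\<^sub>2 g\<^sub>2 f h) a"
  by (rule inv_into_f_eq[OF inj_on_Phi_Cl _ Phi_Cl_incl2[OF assms]])
    (simp add: glue_clifford_def tot_glue incl2_in assms)

text \<open>The first component of the argument selects the branch and the fibre; injectivity there
  lets \<open>inv_into\<close> recover \<open>t\<close>.\<close>

lemma Phi_tensor_incl1:
  assumes x: "x \<in> pts (base V\<^sub>1)" "x \<notin> Y" and t: "t \<in> fibre (tpow n V\<^sub>1) x"
  shows "Phi_tensor n V\<^sub>1 V\<^sub>2 Y f h (word_map (multilin V) (i\<^sub>1 V\<^sub>1 V\<^sub>2 Y f) (j\<^sub>1 V\<^sub>1 V\<^sub>2 Y h) t) =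
    j\<^sub>1 (tpow n V\<^sub>1) (tpow n V\<^sub>2) Y H\<^sub>T t"
proof -
  interpret iso: fibre_iso V\<^sub>1 V "i\<^sub>1 V\<^sub>1 V\<^sub>2 Y f" x "j\<^sub>1 V\<^sub>1 V\<^sub>2 Y h" g\<^sub>1 g
    by (rule fibre_iso_j1[OF x])
  have "fst t = x" using t by (simp add: fibre_iff)
  then show ?thesis
    using x t
    by (simp add: Phi_tensor_def Let_def fst_word_map glue_case_incl1 inv_into_f_f[OF iso.inj_on_tpow])
qed

lemma Phi_tensor_incl2:
  assumes x: "x \<in> pts (base V\<^sub>2)" and t: "t \<in> fibre (tpow n V\<^sub>2) x"
  shows "Phi_tensor n V\<^sub>1 V\<^sub>2 Y f h (word_map (multilin V) (i\<^sub>2 V\<^sub>1 V\<^sub>2 Y f) (j\<^sub>2 V\<^sub>1 V\<^sub>2 Y h) t) =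
    j\<^sub>2 (tpow n V\<^sub>1) (tpow n V\<^sub>2) Y H\<^sub>T t"
proof -
  interpret iso: fibre_iso V\<^sub>2 V "i\<^sub>2 V\<^sub>1 V\<^sub>2 Y f" x "j\<^sub>2 V\<^sub>1 V\<^sub>2 Y h" g\<^sub>2 g
    by (rule fibre_iso_j2[OF x])
  have "fst t = x" using t by (simp add: fibre_iff)
  then show ?thesis
    using x t
    by (simp add: Phi_tensor_def Let_def fst_word_map glue_case_incl2 inv_into_f_f[OF iso.inj_on_tpow])
qed

lemma Phi_sum_incl1:
  assumes x: "x \<in> pts (base V\<^sub>1)" "x \<notin> Y" and s: "s \<in> fibre (dsum k (\<lambda>n. tpow n V\<^sub>1)) x"
  shows "Phi_sum k V\<^sub>1 V\<^sub>2 Y f h (dsum_map k (\<lambda>n. j\<^sub>1 (tpow n V\<^sub>1) (tpow n V\<^sub>2) Y H\<^sub>T) s) =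
    j\<^sub>1 (dsum k (\<lambda>n. tpow n V\<^sub>1)) (dsum k (\<lambda>n. tpow n V\<^sub>2)) Y (H\<^sub>\<Lambda> k) s"
proof -
  let ?J = "dsum_map k (\<lambda>n. j\<^sub>1 (tpow n V\<^sub>1) (tpow n V\<^sub>2) Y H\<^sub>T)"
  \<comment> \<open>\<open>dsum\<close> reads the base point of a tuple from its component in degree
    \<open>0\<close>.\<close>
  have s0: "s 0 \<in> pts (tot (tpow 0 V\<^sub>1))" "fst (s 0) = x"
    using s by (auto simp: fibre_dsum PiE_iff fibre_iff)
  have proj: "proj (dsum k (\<lambda>n. glue_tpow n V\<^sub>1 V\<^sub>2 Y f h)) (?J s) = i\<^sub>1 V\<^sub>1 V\<^sub>2 Y f x"
    using s0 x by (simp add: proj_dsum glue_tpow_def dsum_map_def proj_glue_incl1)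
  \<comment> \<open>Off \<open>Y\<close> the gluing classes are singletons, so the inclusion is
    injective in each degree.\<close>
  have "inj_on ?J (fibre (dsum k (\<lambda>n. tpow n V\<^sub>1)) x)"
    unfolding fibre_dsum
    by (intro inj_on_dsum_map inj_onI) (use x in \<open>auto simp: fibre_iff over_iff incl1_eq\<close>)
  then show ?thesis
    using x s by (simp add: Phi_sum_def Let_def proj glue_case_incl1)
qed

lemma Phi_sum_incl2:
  assumes x: "x \<in> pts (base V\<^sub>2)" and s: "s \<in> fibre (dsum k (\<lambda>n. tpow n V\<^sub>2)) x"
  shows "Phi_sum k V\<^sub>1 V\<^sub>2 Y f h (dsum_map k (\<lambda>n. j\<^sub>2 (tpow n V\<^sub>1) (tpow n V\<^sub>2) Y H\<^sub>T) s) =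
    j\<^sub>2 (dsum k (\<lambda>n. tpow n V\<^sub>1)) (dsum k (\<lambda>n. tpow n V\<^sub>2)) Y (H\<^sub>\<Lambda> k) s"
proof -
  let ?J = "dsum_map k (\<lambda>n. j\<^sub>2 (tpow n V\<^sub>1) (tpow n V\<^sub>2) Y H\<^sub>T)"
  have s0: "s 0 \<in> pts (tot (tpow 0 V\<^sub>2))" "fst (s 0) = x"
    using s by (auto simp: fibre_dsum PiE_iff fibre_iff)
  have proj: "proj (dsum k (\<lambda>n. glue_tpow n V\<^sub>1 V\<^sub>2 Y f h)) (?J s) = i\<^sub>2 V\<^sub>1 V\<^sub>2 Y f x"
    using s0 x by (simp add: proj_dsum glue_tpow_def dsum_map_def proj_glue_incl2)
  have "inj_on ?J (fibre (dsum k (\<lambda>n. tpow n V\<^sub>2)) x)"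
    unfolding fibre_dsum
    by (intro inj_on_dsum_map inj_on_inverseI[where g = out2]) (auto simp: fibre_iff out2_incl2)
  then show ?thesis
    using x s by (simp add: Phi_sum_def Let_def proj glue_case_incl2)
qed

text \<open>After the tensor and sum identifications, the outer \<open>glue_case\<close> extracts
  the representative \<open>e\<close> by \<open>out1\<close> and forms its class anew in the gluing
  of exterior algebras.\<close>

lemma Phi_ext_incl1:
  assumes x: "x \<in> pts (base V\<^sub>1)" "x \<notin> Y" and e: "e \<in> fibre (ext k V\<^sub>1) x"
  shows "Phi_ext k V\<^sub>1 V\<^sub>2 Y f h
      (dsum_map k (\<lambda>n. word_map (multilin V) (i\<^sub>1 V\<^sub>1 V\<^sub>2 Y f) (j\<^sub>1 V\<^sub>1 V\<^sub>2 Y h)) e) =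
    j\<^sub>1 (ext k V\<^sub>1) (ext k V\<^sub>2) Y (H\<^sub>\<Lambda> k) e"
proof -
  interpret bundle_fibre V\<^sub>1 x
    by (rule bundle_fibre1[OF x(1)])
  have s: "e \<in> fibre (dsum k (\<lambda>n. tpow n V\<^sub>1)) x"
    using e fibre_dsum_tpow_ext by blast
  have "dsum_map k (\<lambda>n. Phi_tensor n V\<^sub>1 V\<^sub>2 Y f h)
      (dsum_map k (\<lambda>n. word_map (multilin V) (i\<^sub>1 V\<^sub>1 V\<^sub>2 Y f) (j\<^sub>1 V\<^sub>1 V\<^sub>2 Y h)) e) =
    dsum_map k (\<lambda>n. j\<^sub>1 (tpow n V\<^sub>1) (tpow n V\<^sub>2) Y H\<^sub>T) e"
    using s x by (auto simp: dsum_map_def fibre_dsum PiE_iff Phi_tensor_incl1 intro!: restrict_ext)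
  then show ?thesis
    using Phi_sum_incl1[OF x s] s x by (simp add: Phi_ext_def glue_case_incl1 fibre_iff over_iff)
qed

lemma Phi_ext_incl2:
  assumes x: "x \<in> pts (base V\<^sub>2)" and e: "e \<in> fibre (ext k V\<^sub>2) x"
  shows "Phi_ext k V\<^sub>1 V\<^sub>2 Y f h
      (dsum_map k (\<lambda>n. word_map (multilin V) (i\<^sub>2 V\<^sub>1 V\<^sub>2 Y f) (j\<^sub>2 V\<^sub>1 V\<^sub>2 Y h)) e) =
    j\<^sub>2 (ext k V\<^sub>1) (ext k V\<^sub>2) Y (H\<^sub>\<Lambda> k) e"
proof -
  interpret bundle_fibre V\<^sub>2 x
    by (rule bundle_fibre2[OF x(1)])
  have s: "e \<in> fibre (dsum k (\<lambda>n. tpow n V\<^sub>2)) x"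
    using e fibre_dsum_tpow_ext by blast
  have "dsum_map k (\<lambda>n. Phi_tensor n V\<^sub>1 V\<^sub>2 Y f h)
      (dsum_map k (\<lambda>n. word_map (multilin V) (i\<^sub>2 V\<^sub>1 V\<^sub>2 Y f) (j\<^sub>2 V\<^sub>1 V\<^sub>2 Y h)) e) =
    dsum_map k (\<lambda>n. j\<^sub>2 (tpow n V\<^sub>1) (tpow n V\<^sub>2) Y H\<^sub>T) e"
    using s x by (auto simp: dsum_map_def fibre_dsum PiE_iff Phi_tensor_incl2 intro!: restrict_ext)
  then show ?thesis
    using Phi_sum_incl2[OF x s] s x by (simp add: Phi_ext_def glue_case_incl2 fibre_iff)
qed

text \<open>With \<open>v\<close> and \<open>e\<close> written as images of \<open>a\<close> and
  \<open>d\<close> from one of the two bundles, both sides become the class of that bundle's action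
  of \<open>a\<close> on \<open>d\<close>.\<close>

lemma Phi_ext_clifford_action:
  assumes v: "v \<in> pts (tot (clifford V g))" and e: "e \<in> pts (tot (ext k V))"
    and proj: "proj (clifford V g) v = proj (ext k V) e"
  shows "Phi_ext k V\<^sub>1 V\<^sub>2 Y f h (clifford_action k V g v e) =
    glued_clifford_action k V\<^sub>1 V\<^sub>2 Y f h g\<^sub>1 g\<^sub>2
      (inv_into (pts (tot (glue_clifford V\<^sub>1 V\<^sub>2 Y f h g\<^sub>1 g\<^sub>2))) (Phi_Cl V\<^sub>1 V\<^sub>2 Y f h g\<^sub>1 g\<^sub>2) v)
      (Phi_ext k V\<^sub>1 V\<^sub>2 Y f h e)"
proof -
  define x where "x = proj (clifford V g) v"
  have v_in: "v \<in> fibre (clifford V g) x" and e_in: "e \<in> fibre (ext k V) x"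
    using v e proj by (simp_all add: x_def fibre_iff)
  have "x \<in> pts (base V)"
    using v by (auto simp: x_def clifford_def quot_bundle_def clifford_sp_def)
  \<comment> \<open>Base points that come from \<open>Y\<close> fall under the second case, where
    \<open>V\<^sub>2\<close> describes the fibre.\<close>
  then show ?thesis
  proof (cases rule: base_cases)
    case (1 x\<^sub>1)
    interpret iso: fibre_iso V\<^sub>1 V "i\<^sub>1 V\<^sub>1 V\<^sub>2 Y f" x\<^sub>1 "j\<^sub>1 V\<^sub>1 V\<^sub>2 Y h" g\<^sub>1 g
      by (rule fibre_iso_j1[OF 1(1,2)])
    obtain a where a: "a \<in> fibre (clifford V\<^sub>1 g\<^sub>1) x\<^sub>1" "v = iso.clifford_hom a"
      using v_in iso.clifford_hom_inverse[of v] iso.inverse.clifford_hom_in[of v] by (auto simp: 1(3))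
    obtain d where d: "d \<in> fibre (ext k V\<^sub>1) x\<^sub>1" "e = iso.ext_hom k d"
      using e_in iso.ext_hom_inverse[of e k] iso.inverse.ext_hom_in[of e k] by (auto simp: 1(3))
    \<comment> \<open>Folding to \<open>ext_hom\<close> gives the formula the shape produced by
      \<open>clifford_action_hom\<close>.\<close>
    note Phi_ext = Phi_ext_incl1[OF 1(1,2), folded iso.ext_hom_def]
    have proj_a: "a \<in> pts (tot (clifford V\<^sub>1 g\<^sub>1))" "proj (clifford V\<^sub>1 g\<^sub>1) a = x\<^sub>1"
      using a(1) by (simp_all add: fibre_iff)
    show ?thesis
      using a d proj_a 1 iso.clifford_action_in[of a d k]
      by (simp add: iso.clifford_action_hom Phi_ext glued_clifford_action_def Let_def glue_clifford_def
          inv_Phi_Cl_incl1[folded iso.clifford_hom_def, unfolded glue_clifford_def]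
          proj_glue_incl1 glue_case_incl1 out1_incl1 fibre_iff over_iff ext_def proj_dsum)
  next
    case (2 x\<^sub>2)
    interpret iso: fibre_iso V\<^sub>2 V "i\<^sub>2 V\<^sub>1 V\<^sub>2 Y f" x\<^sub>2 "j\<^sub>2 V\<^sub>1 V\<^sub>2 Y h" g\<^sub>2 g
      by (rule fibre_iso_j2[OF 2(1)])
    obtain a where a: "a \<in> fibre (clifford V\<^sub>2 g\<^sub>2) x\<^sub>2" "v = iso.clifford_hom a"
      using v_in iso.clifford_hom_inverse[of v] iso.inverse.clifford_hom_in[of v] by (auto simp: 2(2))
    obtain d where d: "d \<in> fibre (ext k V\<^sub>2) x\<^sub>2" "e = iso.ext_hom k d"
      using e_in iso.ext_hom_inverse[of e k] iso.inverse.ext_hom_in[of e k] by (auto simp: 2(2))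
    note Phi_ext = Phi_ext_incl2[OF 2(1), folded iso.ext_hom_def]
    have proj_a: "a \<in> pts (tot (clifford V\<^sub>2 g\<^sub>2))" "proj (clifford V\<^sub>2 g\<^sub>2) a = x\<^sub>2"
      using a(1) by (simp_all add: fibre_iff)
    show ?thesis
      using a d proj_a 2 iso.clifford_action_in[of a d k]
      by (simp add: iso.clifford_action_hom Phi_ext glued_clifford_action_def Let_def glue_clifford_def
          inv_Phi_Cl_incl2[folded iso.clifford_hom_def, unfolded glue_clifford_def]
          proj_glue_incl2 glue_case_incl2 out2_incl2 fibre_iff)
  qed
qed

end

theorem theorem8p3:
  fixes V\<^sub>1 :: "('v, 'x) pbundle" and V\<^sub>2 :: "('w, 'y) pbundle"
    and Y :: "'x set" and f :: "'x \<Rightarrow> 'y" and h :: "'v \<Rightarrow> 'w"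
    and g\<^sub>1 :: "'x \<Rightarrow> 'v \<Rightarrow> 'v \<Rightarrow> real" and g\<^sub>2 :: "'y \<Rightarrow> 'w \<Rightarrow> 'w \<Rightarrow> real"
    and v :: "('x + 'y) set \<times> ('v + 'w) set words set"
    and e :: "nat \<Rightarrow> ('x + 'y) set \<times> ('v + 'w) set words set"
  defines "k \<equiv> dim_V V\<^sub>1 V\<^sub>2"
    and "V \<equiv> glue V\<^sub>1 V\<^sub>2 Y f h"
    and "g \<equiv> glue_metric g\<^sub>1 g\<^sub>2"
    and "\<Phi>\<^sub>C\<^sub>l \<equiv> Phi_Cl V\<^sub>1 V\<^sub>2 Y f h g\<^sub>1 g\<^sub>2"
    and "\<Phi>\<^sub>\<Lambda> \<equiv> Phi_ext (dim_V V\<^sub>1 V\<^sub>2) V\<^sub>1 V\<^sub>2 Y f h"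
  assumes "pseudo_bundle V\<^sub>1" and "fin_dim_bundle V\<^sub>1" and "locally_trivial V\<^sub>1"
    and "pseudo_bundle V\<^sub>2" and "fin_dim_bundle V\<^sub>2" and "locally_trivial V\<^sub>2"
    and "bdd_above (fibre_dims V\<^sub>1 \<union> fibre_dims V\<^sub>2)"
    and "gluing V\<^sub>1 V\<^sub>2 Y f h"
    and "diffeo_onto_image (base V\<^sub>1) (base V\<^sub>2) Y f"
    and "diffeo_onto_image (tot (dual V\<^sub>2)) (tot (dual V\<^sub>1)) (over (dual V\<^sub>2) (f ` Y)) (dual_map V\<^sub>1 Y f h)"
    and "pseudo_metric V\<^sub>1 g\<^sub>1" and "pseudo_metric V\<^sub>2 g\<^sub>2"
    and "compatible_metrics V\<^sub>1 Y f h g\<^sub>1 g\<^sub>2"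
    and "v \<in> pts (tot (clifford V g))" and "e \<in> pts (tot (ext k V))"
    and "proj (clifford V g) v = proj (ext k V) e"
  shows "\<Phi>\<^sub>\<Lambda> (clifford_action k V g v e) =
    glued_clifford_action k V\<^sub>1 V\<^sub>2 Y f h g\<^sub>1 g\<^sub>2
      (inv_into (pts (tot (glue_clifford V\<^sub>1 V\<^sub>2 Y f h g\<^sub>1 g\<^sub>2))) \<Phi>\<^sub>C\<^sub>l v) (\<Phi>\<^sub>\<Lambda> e)"
proof -
  interpret metric_gluing V\<^sub>1 V\<^sub>2 Y f h g\<^sub>1 g\<^sub>2
    by unfold_locales fact+
  show ?thesis
    \<comment> \<open>The five \<open>defines\<close> clauses count as assumptions, so these three
      are the conditions on \<open>v\<close> and \<open>e\<close>.\<close>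
    using assms(19-21) Phi_ext_clifford_action unfolding k_def V_def g_def \<Phi>\<^sub>C\<^sub>l_def \<Phi>\<^sub>\<Lambda>_def by blast
qed

end
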